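(* Let $A\in\mathbb{R}^{n\times n}$ be nonsingular and $SSR_k$ for some $k\in\{1,\dots,n-1\}$, and let $\epsilon_k\in\{-1,1\}$ be the common sign of its minors of order $k$. Let $\lambda_1,\dots,\lambda_n$ be the eigenvalues of $A$, ordered so that $|\lambda_1|\ge|\lambda_2|\ge\dots\ge|\lambda_n|>0$ with complex conjugate eigenvalues appearing in consecutive pairs, and let $v^1,\dots,v^n\in\mathbb{C}^n$ be the corresponding eigenvectors. Then: (i) The product $\lambda_1\lambda_2\cdots\lambda_k$ is real, and $\epsilon_k\lambda_1\lambda_2\cdots\lambda_k>0$. (ii) $|\lambda_k|>|\lambda_{k+1}|$. (iii) For all $1\le p\le k$, $k+1\le q\le n$, and $c_p,\dots,c_q\in\mathbb{C}$ such that $c_p,\dots,c_k$ match the eigenvectors $v^p,\dots,v^k$ and $c_{k+1},\dots,c_q$ match the eigenvectors $v^{k+1},\dots,v^q$, we have $$s^+\Big(\sum_{i=p}^k c_iv^i\Big)\le k-1\quad\text{and}\quad s^-\Big(\sum_{i=k+1}^q c_iv^i\Big)\ge k.$$ (iv) Let $u^1,\dots,u^n\in\mathbb{R}^n$ be the real vectors constructed from $v^1,\dots,v^n$ (as described in the context). Then $u^1,\dots,u^k$ are linearly independent. In particular, if $v^1,\dots,v^k$ are real then they are linearly independent.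
   Context: A matrix is $SSR_k$ (strictly sign-regular of order $k$) if all its $k\times k$ minors are non-zero and have the same sign. For $y\in\mathbb{R}^n$, $s^-(y)$ is the number of sign variations in $y$ after deleting all its zero entries, and $s^+(y)$ is the maximal possible number of sign variations in $y$ after each zero entry is replaced by either $+1$ or $-1$. "Complex" for a number or vector means non-real. Conventions on eigenvectors: no $v^i$ is purely imaginary (otherwise it is replaced by its imaginary part); each $v^i$ is either real or belongs to a consecutive complex conjugate pair $v^i,\ v^{i+1}=\overline{v^i}$; for complex $v^i$ the real and imaginary parts are linearly independent. Matching: a set $c_p,\dots,c_k\in\mathbb{C}$, $p\le k$, matches the consecutive eigenvectors $v^p,\dots,v^k$ if the $c_i$ are not all zero and, for every $i$, if $v^i$ is real then $c_i$ is real, and if $v^i,v^{i+1}$ is a complex conjugate pair then $c_{i+1}=\overline{c_i}$; in particular $\sum_{i=p}^k c_iv^i\in\mathbb{R}^n$ (the list $v^p,\dots,v^k$ is understood not to split a complex conjugate pair). Construction of $u^1,\dots,u^n$: go through $v^1,v^2,\dots$ in order. If $v^1$ is real put $u^1:=v^1$ and proceed to $v^2$; if $v^1$ is complex (so $v^2=\overline{v^1}$) put $u^1:=\operatorname{Re}(v^1)$, $u^2:=\operatorname{Im}(v^1)$ and proceed to $v^3$; and so on.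
   Formalization: In (iii) and (iv) the eigenvectors listed for the same multiple eigenvalue (among v^p,…,v^q, resp. v^1,…,v^k) are assumed linearly independent; otherwise, e.g. for a defective eigenvalue with a repeated eigenvector, both parts fail. *)

theory Defs
  imports
    "Jordan_Normal_Form.DL_Submatrix"
    "Jordan_Normal_Form.Determinant"
    "Jordan_Normal_Form.Char_Poly"
    "Jordan_Normal_Form.VS_Connect"
begin

text \<open>
  Rows and columns of matrices and entries of vectors are numbered from 0, as in
  the library. Families of eigenvalues, eigenvectors and coefficients are functions
  on \<^typ>\<open>nat\<close> of which only the values at \<open>1, \<dots>, n\<close> matter.
\<close>

definition minors :: "nat \<Rightarrow> 'a :: comm_ring_1 mat \<Rightarrow> 'a set" where
  "minors k A = {det (submatrix A I J) | I J.
     I \<subseteq> {..<dim_row A} \<and> J \<subseteq> {..<dim_col A} \<and> card I = k \<and> card J = k}"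

definition SSR :: "nat \<Rightarrow> real mat \<Rightarrow> bool" where
  "SSR k A \<longleftrightarrow> 0 \<notin> minors k A \<and> (\<forall>x \<in> minors k A. \<forall>y \<in> minors k A. sgn x = sgn y)"


text \<open>In the next definition a zero entry never contributes, since the product is then 0.\<close>

definition sign_var :: "real list \<Rightarrow> nat" where
  "sign_var xs = card {i. Suc i < length xs \<and> xs ! i * xs ! Suc i < 0}"

definition s_minus :: "real vec \<Rightarrow> nat" where
  "s_minus y = sign_var (filter (\<lambda>a. a \<noteq> 0) (list_of_vec y))"

definition s_plus :: "real vec \<Rightarrow> nat" where
  "s_plus y = Max {sign_var (list_of_vec z) | z. dim_vec z = dim_vec y \<and>
     (\<forall>i < dim_vec y. if y $ i = 0 then z $ i \<in> {1, -1} else z $ i = y $ i)}"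


abbreviation Re_vec :: "complex vec \<Rightarrow> real vec" where
  "Re_vec \<equiv> map_vec Re"

abbreviation Im_vec :: "complex vec \<Rightarrow> real vec" where
  "Im_vec \<equiv> map_vec Im"

text \<open>
  Linear independence of an indexed family: injectivity rules out repeated vectors,
  which independence of the image alone would not.
\<close>

definition lin_indpt_family :: "nat \<Rightarrow> ('i \<Rightarrow> 'a :: field vec) \<Rightarrow> 'i set \<Rightarrow> bool" where
  "lin_indpt_family n f I \<longleftrightarrow>
     inj_on f I \<and> \<not> module.lin_dep class_ring (module_vec TYPE('a) n) (f ` I)"


text \<open>
  Going through \<open>f 1, f 2, \<dots>\<close> in order, \<open>pair_start f i\<close> says that \<open>f i\<close> is non-real
  and is the first member of its conjugate pair.
\<close>

fun pair_start :: "(nat \<Rightarrow> 'a :: conjugate) \<Rightarrow> nat \<Rightarrow> bool" where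
  "pair_start f 0 \<longleftrightarrow> False"
| "pair_start f (Suc i) \<longleftrightarrow> conjugate (f (Suc i)) \<noteq> f (Suc i) \<and> \<not> pair_start f i"

definition conj_paired :: "nat \<Rightarrow> (nat \<Rightarrow> 'a :: conjugate) \<Rightarrow> bool" where
  "conj_paired n f \<longleftrightarrow>
     (\<forall>i \<in> {1..n}. pair_start f i \<longrightarrow> i < n \<and> f (Suc i) = conjugate (f i))"

text \<open>
  The eigenvalues of \<open>A\<close> with algebraic multiplicity, in order of decreasing modulus.
\<close>

definition ordered_eigenvalues :: "nat \<Rightarrow> real mat \<Rightarrow> (nat \<Rightarrow> complex) \<Rightarrow> bool" where
  "ordered_eigenvalues n A lam \<longleftrightarrow>
     char_poly (map_mat complex_of_real A) = (\<Prod>i = 1..n. [:- lam i, 1:]) \<and>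
     (\<forall>i j. 1 \<le> i \<and> i \<le> j \<and> j \<le> n \<longrightarrow> cmod (lam i) \<ge> cmod (lam j)) \<and>
     cmod (lam n) > 0 \<and>
     conj_paired n lam"

definition corresponding_eigenvectors ::
    "nat \<Rightarrow> real mat \<Rightarrow> (nat \<Rightarrow> complex) \<Rightarrow> (nat \<Rightarrow> complex vec) \<Rightarrow> bool" where
  "corresponding_eigenvectors n A lam v \<longleftrightarrow>
     (\<forall>i \<in> {1..n}. eigenvector (map_mat complex_of_real A) (v i) (lam i)) \<and>
     (\<forall>i \<in> {1..n}. Re_vec (v i) \<noteq> 0\<^sub>v n) \<and>
     conj_paired n v \<and>
     (\<forall>i \<in> {1..n}. conjugate (v i) \<noteq> v i \<longrightarrow>
        lin_indpt_family n (\<lambda>b. if b then Re_vec (v i) else Im_vec (v i)) UNIV)"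

text \<open>
  The eigenvectors listed in \<open>I\<close> for one and the same eigenvalue are linearly
  independent. This holds automatically if the \<open>lam i\<close>, \<open>i \<in> I\<close>, are distinct. It excludes
  repeating (multiples of) an eigenvector for a multiple eigenvalue.
\<close>

definition indep_in_eigenspaces ::
    "nat \<Rightarrow> (nat \<Rightarrow> complex) \<Rightarrow> (nat \<Rightarrow> complex vec) \<Rightarrow> nat set \<Rightarrow> bool" where
  "indep_in_eigenspaces n lam v I \<longleftrightarrow> (\<forall>\<mu>. lin_indpt_family n v {i \<in> I. lam i = \<mu>})"

text \<open>
  \<open>matches v p k c\<close>: the coefficients \<open>c p, \<dots>, c k\<close> match \<open>v p, \<dots>, v k\<close>. The conditions
  \<open>\<not> pair_start v (p - 1)\<close> and \<open>i < k\<close> say that the list does not split a conjugate pair.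
\<close>

definition matches :: "(nat \<Rightarrow> complex vec) \<Rightarrow> nat \<Rightarrow> nat \<Rightarrow> (nat \<Rightarrow> complex) \<Rightarrow> bool" where
  "matches v p k c \<longleftrightarrow>
     \<not> pair_start v (p - 1) \<and>
     (\<exists>i \<in> {p..k}. c i \<noteq> 0) \<and>
     (\<forall>i \<in> {p..k}. conjugate (v i) = v i \<longrightarrow> c i \<in> \<real>) \<and>
     (\<forall>i \<in> {p..k}. pair_start v i \<longrightarrow> i < k \<and> c (Suc i) = cnj (c i))"

definition eig_comb ::
    "nat \<Rightarrow> (nat \<Rightarrow> complex) \<Rightarrow> (nat \<Rightarrow> complex vec) \<Rightarrow> nat \<Rightarrow> nat \<Rightarrow> complex vec" where
  "eig_comb n c v p q = finsum_vec TYPE(complex) n (\<lambda>i. c i \<cdot>\<^sub>v v i) {p..q}"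

definition real_family :: "(nat \<Rightarrow> complex vec) \<Rightarrow> nat \<Rightarrow> real vec" where
  "real_family v i = (if pair_start v (i - 1) then Im_vec (v (i - 1)) else Re_vec (v i))"

lemma eig_comb_index:
  assumes "\<And>i. i \<in> {p..q} \<Longrightarrow> v i \<in> carrier_vec n" and "j < n"
  shows "eig_comb n c v p q $ j = (\<Sum>i = p..q. c i * v i $ j)"
proof -
  have "eig_comb n c v p q $ j = (\<Sum>i \<in> {p..q}. (c i \<cdot>\<^sub>v v i) $ j)"
    unfolding eig_comb_def using assms by (intro index_finsum_vec) auto
  also have "\<dots> = (\<Sum>i = p..q. c i * v i $ j)"
    using assms by (intro sum.cong refl index_smult_vec) (metis carrier_vecD)
  finally show ?thesis .
qed

text \<open>
  A matching combination is a real vector, so nothing is lost by passing to its real part.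
\<close>

lemma matches_imp_real:
  assumes v: "\<And>i. i \<in> {1..n} \<Longrightarrow> v i \<in> carrier_vec m" and cp: "conj_paired n v"
    and mt: "matches v p q c" and pq: "1 \<le> p" "q \<le> n"
  shows "map_vec complex_of_real (Re_vec (eig_comb m c v p q)) = eig_comb m c v p q"
proof -
  have *: "(\<Sum>i = p..r. c i * v i $ j) \<in> \<real>" if "r \<le> q" "\<not> pair_start v r" "j < m" for r j
    using that
  proof (induction r rule: less_induct)
    case (less r)
    show ?case
    proof (cases "r < p")
      case True
      then show ?thesis by simp
    next
      case False
      then obtain s where r: "r = Suc s" using pq by (cases r) auto
      have rn: "r \<in> {p..q}" "r \<in> {1..n}" using False less.prems pq by auto
      show ?thesis
      proof (cases "pair_start v s")
        case False
        then have re: "conjugate (v r) = v r" using less.prems(2) r by simp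
        have cr: "c r \<in> \<real>" using mt rn re by (auto simp: matches_def)
        have "conjugate (v r) $ j = cnj (v r $ j)"
          using v[OF rn(2)] less.prems by (subst vec_index_conjugate) auto
        then have vr: "v r $ j \<in> \<real>" using re by (simp add: Reals_cnj_iff)
        have "(\<Sum>i = p..s. c i * v i $ j) \<in> \<real>"
          using less.IH[of s] less.prems False r by simp
        moreover have "(\<Sum>i = p..r. c i * v i $ j) = (\<Sum>i = p..s. c i * v i $ j) + c r * v r $ j"
          using r rn by simp
        ultimately show ?thesis using cr vr by auto
      next
        case True
        then obtain t where s: "s = Suc t" by (cases s) auto
        have "s \<noteq> p - 1" using True mt by (auto simp: matches_def)
        then have sp: "s \<in> {p..q}" "s \<in> {1..n}" using rn r s pq by auto
        have vs: "v r = conjugate (v s)"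
          using cp True sp r by (auto simp: conj_paired_def)
        have cs: "c r = cnj (c s)" using mt True sp r by (auto simp: matches_def)
        have "v r $ j = cnj (v s $ j)"
          using v[OF sp(2)] less.prems unfolding vs by (subst vec_index_conjugate) auto
        then have "c s * v s $ j + c r * v r $ j \<in> \<real>"
          by (simp add: cs Reals_cnj_iff add.commute)
        moreover have "\<not> pair_start v t" using True s by simp
        then have "(\<Sum>i = p..t. c i * v i $ j) \<in> \<real>"
          using less.IH[of t] less.prems r s by simp
        moreover have "(\<Sum>i = p..r. c i * v i $ j) =
            (\<Sum>i = p..t. c i * v i $ j) + (c s * v s $ j + c r * v r $ j)"
          using r s sp rn by (simp add: add.assoc)
        ultimately show ?thesis by (metis Reals_add)
      qed
    qed
  qed
  have ne: "p \<le> q" using mt by (auto simp: matches_def)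
  have nps: "\<not> pair_start v q" using mt ne by (auto simp: matches_def)
  have vc: "\<And>i. i \<in> {p..q} \<Longrightarrow> v i \<in> carrier_vec m" using v pq by auto
  have dim: "eig_comb m c v p q \<in> carrier_vec m"
    unfolding eig_comb_def using vc by (intro finsum_vec_closed) auto
  show ?thesis
  proof (rule eq_vecI)
    fix j assume "j < dim_vec (eig_comb m c v p q)"
    then have j: "j < m" using dim by auto
    have "eig_comb m c v p q $ j = (\<Sum>i = p..q. c i * v i $ j)"
      by (rule eig_comb_index) (use vc j in auto)
    then have "eig_comb m c v p q $ j \<in> \<real>"
      using *[OF order_refl nps j] by (simp only:)
    then show "map_vec complex_of_real (Re_vec (eig_comb m c v p q)) $ j = eig_comb m c v p q $ j"
      using dim j by auto
  qed simp
qed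

end

theory Submission
  imports Defs "Jordan_Normal_Form.Schur_Decomposition" "HOL-Analysis.Function_Topology"
begin

text \<open>
  Up to the sign \<open>\<epsilon>\<close>, the matrix of minors of order \<open>k\<close> of \<open>A\<close> is positive. By Cauchy-Binet a Schur
  decomposition \<open>A P = P T\<close> triangularises it, with diagonal entries the products of \<open>k\<close> eigenvalues.
  Perron's theorem then makes \<open>\<epsilon> \<lambda>\<^sub>1 \<cdots> \<lambda>\<^sub>k\<close> positive and simple among the
  eigenvalues of largest modulus, so that \<open>\<bar>\<lambda>\<^sub>k\<bar>\<close> exceeds the next modulus, and shows that the minors of
  order \<open>k\<close> of the first \<open>k\<close> columns of \<open>P\<close> are one complex unit times positive numbers. The
  eigenvectors for the first \<open>k\<close> eigenvalues lie in the span of these columns. The others are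
  orthogonal to the corresponding span for the transpose of \<open>A\<close>. Both sign variation bounds are
  Laplace expansions in which all terms would have the same sign.
\<close>

section \<open>Minors and the Cauchy-Binet formula\<close>

text \<open>A multiple eigenvalue may leave \<open>A\<close> without an eigenbasis, so eigenvectors
  cannot serve as the columns of \<open>P\<close>. A Schur basis always exists, the order of its
  diagonal can be prescribed, and only the flag of leading column spans matters. The price is that
  its columns are complex, so positivity of the minors holds only up to a unit
  \<open>\<theta>\<close>; as a common nonzero factor it cancels from the vanishing sums in which it
  occurs.

  For the strict gap a dominant eigenvector alone does not suffice: equal moduli could come from a
  second eigenvalue on the same circle or from a Jordan block. Both are excluded on the two lowest
  columns of the compound of \<open>P\<close>, those of {0, ..., k-1} and {0, ..., k-2, k}, whose
  diagonal products differ only in their last factor.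

  The two sign bounds are asymmetric because nothing is known about minors of the trailing columns
  of \<open>P\<close>. A vector in the second group is therefore described by k linear equations
  instead of by coordinates, and the coefficients of these equations again have one-signed
  minors.\<close>

definition index_sets :: "nat \<Rightarrow> nat \<Rightarrow> nat set set" where
  "index_sets n k = {I. I \<subseteq> {..<n} \<and> card I = k}"

text \<open>The last equation is there because \<open>submatrix\<close> measures its dimensions by
  sets of this form.\<close>

lemma index_setsD:
  assumes "I \<in> index_sets n k"
  shows "I \<subseteq> {..<n}" "card I = k" "finite I" "{i. i < n \<and> i \<in> I} = I"
  using assms by (auto simp: index_sets_def intro: finite_subset)

lemma finite_index_sets: "finite (index_sets n k)"
  by (rule finite_subset[of _ "Pow {..<n}"]) (auto simp: index_sets_def)

lemma pick_index_sets:
  assumes "I \<in> index_sets n k" "a < k"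
  shows "pick I a \<in> I" "pick I a < n"
proof -
  show "pick I a \<in> I" using assms(2) index_setsD(2)[OF assms(1)] by (intro pick_in_set_le) simp
  then show "pick I a < n" using index_setsD(1)[OF assms(1)] by auto
qed

lemma pick_less_pick:
  assumes "I \<in> index_sets n k" "a < b" "b < k"
  shows "pick I a < pick I b"
  using pick_mono_le[of b I a] assms index_setsD(2)[OF assms(1)] by simp

lemma pick_le_pick:
  assumes "I \<in> index_sets n k" "a \<le> b" "b < k"
  shows "pick I a \<le> pick I b"
  using pick_less_pick[OF assms(1), of a b] assms by (cases "a = b") auto

lemma card_below_pick:
  assumes "I \<in> index_sets n k" "a < k"
  shows "card {i \<in> I. i < pick I a} = a"
  using card_pick_le[of a I] assms index_setsD(2)[OF assms(1)] by simp

lemma bij_betw_pick: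
  assumes "I \<in> index_sets n k"
  shows "bij_betw (pick I) {0..<k} I"
proof -
  have inj: "inj_on (pick I) {0..<k}"
    by (rule inj_onI) (metis assms atLeastLessThan_iff linorder_neqE_nat order_less_irrefl pick_less_pick)
  moreover have "pick I ` {0..<k} \<subseteq> I" using pick_index_sets(1)[OF assms] by auto
  then have "pick I ` {0..<k} = I"
    by (rule card_subset_eq[OF index_setsD(3)[OF assms]])
       (use card_image[OF inj] index_setsD(2)[OF assms] in simp)
  ultimately show ?thesis by (simp add: bij_betw_def)
qed

lemma card_below_less:
  assumes "I \<in> index_sets n k" "i \<in> I"
  shows "card {b \<in> I. b < i} < k"
proof -
  have "{b \<in> I. b < i} \<subset> I" using assms(2) by auto
  then have "card {b \<in> I. b < i} < card I" by (rule psubset_card_mono[OF index_setsD(3)[OF assms(1)]])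
  then show ?thesis by (simp only: index_setsD(2)[OF assms(1)])
qed

lemma submatrix_carrier:
  assumes "M \<in> carrier_mat r n" "I \<in> index_sets r k" "J \<in> index_sets n l"
  shows "submatrix M I J \<in> carrier_mat k l"
  using assms(1) by (intro carrier_matI)
    (simp_all only: carrier_matD dim_submatrix index_setsD(2,4)[OF assms(2)] index_setsD(2,4)[OF assms(3)])

lemma submatrix_eq:
  assumes "M \<in> carrier_mat r n" "I \<in> index_sets r k" "J \<in> index_sets n l"
  shows "submatrix M I J = mat k l (\<lambda>(a, b). M $$ (pick I a, pick J b))"
  using assms(1) by (simp only: submatrix_def carrier_matD
    index_setsD(2,4)[OF assms(2)] index_setsD(2,4)[OF assms(3)])

text \<open>The map sends i to the rank of \<open>f i\<close> in the image. It is injective because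
  \<open>pick\<close> recovers \<open>f i\<close> from its rank. In the Cauchy-Binet formula it is
  the permutation that sorts a choice of rows.\<close>

lemma rank_permutes:
  fixes f :: "nat \<Rightarrow> nat"
  assumes f: "inj_on f {0..<k}"
  shows "(\<lambda>i. if i < k then card {b \<in> f ` {0..<k}. b < f i} else i) permutes {0..<k}" (is "?p permutes _")
proof (rule bij_imp_permutes)
  let ?L = "f ` {0..<k}"
  \<comment> \<open>There is no ambient size, so the least bound that fits is taken. For k = 0 the
    image is empty and the unspecified \<open>Max\<close> does no harm.\<close>
  have L: "?L \<in> index_sets (Suc (Max ?L)) k"
    using f by (auto simp: index_sets_def card_image less_Suc_eq_le)
  have pk: "pick ?L (card {b \<in> ?L. b < f i}) = f i" if "i < k" for i
    by (rule pick_card_in_set) (use that in auto)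
  have inj: "inj_on ?p {0..<k}"
    by (rule inj_onI) (metis (no_types, lifting) pk f inj_onD atLeastLessThan_iff)
  have "?p ` {0..<k} \<subseteq> {0..<k}" using card_below_less[OF L] by auto
  then show "bij_betw ?p {0..<k} {0..<k}"
    unfolding bij_betw_def by (intro conjI inj endo_inj_surj) auto
qed auto

text \<open>Multiplying out all rows gives a sum over functions \<open>f\<close> that choose one
  inner index per row. A choice with a repetition produces two equal rows; the injective choices are
  grouped by their image.\<close>

lemma cauchy_binet_mat:
  fixes m q :: "nat \<Rightarrow> nat \<Rightarrow> 'a :: comm_ring_1"
  shows "det (mat k k (\<lambda>(i, j). \<Sum>l<n. m i l * q l j)) =
    (\<Sum>L\<in>index_sets n k. det (mat k k (\<lambda>(i, a). m i (pick L a))) * det (mat k k (\<lambda>(a, j). q (pick L a) j)))"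
proof -
  let ?P = "{p. p permutes {0..<k}}"
  let ?PE = "PiE {0..<k} (\<lambda>_. {..<n})"
  let ?D = "\<lambda>f. det (mat k k (\<lambda>(i, j). q (f i) j))"
  have fP: "finite ?P" by (simp add: finite_permutations)
  have fPE: "finite ?PE" by (intro finite_PiE) auto
  have lt: "p i < k" if "p permutes {0..<k}" "i < k" for p i
    using permutes_in_image[OF that(1), of i] that(2) by simp
  have "det (mat k k (\<lambda>(i, j). \<Sum>l<n. m i l * q l j)) =
      (\<Sum>p\<in>?P. signof p * (\<Prod>i = 0..<k. \<Sum>l<n. m i l * q l (p i)))"
    by (subst det_def'[of _ k]) (auto intro!: sum.cong prod.cong simp: lt)
  also have "\<dots> = (\<Sum>p\<in>?P. signof p * (\<Sum>f\<in>?PE. \<Prod>i = 0..<k. m i (f i) * q (f i) (p i)))"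
    by (subst prod_sum_PiE) auto
  also have "\<dots> = (\<Sum>f\<in>?PE. (\<Prod>i = 0..<k. m i (f i)) * (\<Sum>p\<in>?P. signof p * (\<Prod>i = 0..<k. q (f i) (p i))))"
    unfolding sum_distrib_left by (subst sum.swap) (auto intro!: sum.cong simp: prod.distrib algebra_simps)
  also have "\<dots> = (\<Sum>f\<in>?PE. (\<Prod>i = 0..<k. m i (f i)) * ?D f)"
    by (intro sum.cong refl arg_cong2[where f = "(*)"], subst det_def'[of _ k])
       (auto intro!: sum.cong prod.cong simp: lt)
  also have "\<dots> = (\<Sum>f\<in>{f \<in> ?PE. inj_on f {0..<k}}. (\<Prod>i = 0..<k. m i (f i)) * ?D f)"
  proof (rule sum.mono_neutral_right[OF fPE])
    show "\<forall>f\<in>?PE - {f \<in> ?PE. inj_on f {0..<k}}. (\<Prod>i = 0..<k. m i (f i)) * ?D f = 0"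
    proof
      fix f assume "f \<in> ?PE - {f \<in> ?PE. inj_on f {0..<k}}"
      then obtain a b where ab: "a < k" "b < k" "a \<noteq> b" "f a = f b" by (auto simp: inj_on_def)
      have "?D f = 0" by (rule det_identical_rows[OF _ ab(3) ab(1) ab(2)]) (use ab in auto)
      then show "(\<Prod>i = 0..<k. m i (f i)) * ?D f = 0" by simp
    qed
  qed auto
  \<comment> \<open>An injective choice amounts to its image \<open>L\<close> and the permutation of
    ranks. The restriction in the inverse map restores the extensionality that \<open>PiE\<close>
    demands.\<close>
  also have "\<dots> = (\<Sum>(L, p)\<in>index_sets n k \<times> ?P.
      signof p * (\<Prod>i = 0..<k. m i (pick L (p i))) * det (mat k k (\<lambda>(a, j). q (pick L a) j)))"
  proof (rule sum.reindex_bij_witness[where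
        j = "\<lambda>f. (f ` {0..<k}, \<lambda>i. if i < k then card {b \<in> f ` {0..<k}. b < f i} else i)"
        and i = "\<lambda>(L, p). restrict (\<lambda>i. pick L (p i)) {0..<k}"], goal_cases)
    case (1 f)
    then show ?case by (auto simp: fun_eq_iff pick_card_in_set PiE_def extensional_def)
  next
    case (2 f)
    then have f: "f \<in> ?PE" "inj_on f {0..<k}" by auto
    let ?L = "f ` {0..<k}"
    let ?p = "\<lambda>i. if i < k then card {b \<in> ?L. b < f i} else i"
    have L: "?L \<in> index_sets n k" using f by (auto simp: index_sets_def card_image)
    have "?p permutes {0..<k}" by (rule rank_permutes[OF f(2)])
    then show ?case using L by simp
  next
    case (3 Lp)
    obtain L p where Lp: "Lp = (L, p)" and L: "L \<in> index_sets n k" and p: "p permutes {0..<k}"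
      using 3 by (cases Lp) auto
    have im: "(\<lambda>i. pick L (p i)) ` {0..<k} = L"
      using bij_betw_pick[OF L] permutes_image[OF p] by (simp add: image_image[symmetric] bij_betw_def)
    have "card {b \<in> L. b < pick L (p i)} = p i" if "i < k" for i
      using card_below_pick[OF L lt[OF p that]] .
    moreover have "p i = i" if "\<not> i < k" for i using p that by (auto simp: permutes_def)
    ultimately show ?case using im unfolding Lp by (auto simp: fun_eq_iff)
  next
    case (4 Lp)
    obtain L p where Lp: "Lp = (L, p)" and L: "L \<in> index_sets n k" and p: "p permutes {0..<k}"
      using 4 by (cases Lp) auto
    have "inj_on (pick L \<circ> p) {0..<k}"
      using bij_betw_pick[OF L] permutes_image[OF p] permutes_inj_on[OF p]
      by (intro comp_inj_on) (auto simp: bij_betw_def)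
    then show ?case unfolding Lp using pick_index_sets[OF L] lt[OF p] by (auto simp: inj_on_def)
  next
    case (5 f)
    then have f: "f \<in> ?PE" "inj_on f {0..<k}" by auto
    let ?L = "f ` {0..<k}"
    let ?p = "\<lambda>i. if i < k then card {b \<in> ?L. b < f i} else i"
    have L: "?L \<in> index_sets n k" using f by (auto simp: index_sets_def card_image)
    have "?p permutes {0..<k}" by (rule rank_permutes[OF f(2)])
    note p = this
    have pk: "pick ?L (?p i) = f i" if "i < k" for i
      using that by (simp add: pick_card_in_set)
    \<comment> \<open>Sorting the rows extracts the sign of the rank permutation, which is just the
      sign that the other factor needs to become a determinant.\<close>
    have "?D f = det (mat k k (\<lambda>(i, j). mat k k (\<lambda>(a, j). q (pick ?L a) j) $$ (?p i, j)))"
      using pk lt[OF p] by (intro arg_cong[where f = det] cong_mat) auto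
    also have "\<dots> = signof ?p * det (mat k k (\<lambda>(a, j). q (pick ?L a) j))"
      by (rule det_permute_rows[OF _ p]) simp
    finally have D: "?D f = signof ?p * det (mat k k (\<lambda>(a, j). q (pick ?L a) j))" .
    have "(\<Prod>i = 0..<k. m i (f i)) = (\<Prod>i = 0..<k. m i (pick ?L (?p i)))"
      using pk by (intro prod.cong) auto
    then show ?case unfolding D by simp
  qed
  also have "\<dots> = (\<Sum>L\<in>index_sets n k. det (mat k k (\<lambda>(i, a). m i (pick L a))) * det (mat k k (\<lambda>(a, j). q (pick L a) j)))"
    unfolding sum.cartesian_product[symmetric]
  proof (intro sum.cong refl)
    fix L
    have "det (mat k k (\<lambda>(i, a). m i (pick L a))) = (\<Sum>p\<in>?P. signof p * (\<Prod>i = 0..<k. m i (pick L (p i))))"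
      by (subst det_def'[of _ k]) (auto intro!: sum.cong prod.cong simp: lt)
    then show "(\<Sum>p\<in>?P. signof p * (\<Prod>i = 0..<k. m i (pick L (p i))) * det (mat k k (\<lambda>(a, j). q (pick L a) j))) =
        det (mat k k (\<lambda>(i, a). m i (pick L a))) * det (mat k k (\<lambda>(a, j). q (pick L a) j))"
      by (simp add: sum_distrib_right)
  qed
  finally show ?thesis .
qed

lemma cauchy_binet:
  fixes M N :: "'a :: comm_ring_1 mat"
  assumes M: "M \<in> carrier_mat r n" and N: "N \<in> carrier_mat n s"
    and I: "I \<in> index_sets r k" and J: "J \<in> index_sets s k"
  shows "det (submatrix (M * N) I J) =
    (\<Sum>L\<in>index_sets n k. det (submatrix M I L) * det (submatrix N L J))"
proof -
  have "submatrix (M * N) I J = mat k k (\<lambda>(i, j). \<Sum>l<n. M $$ (pick I i, l) * N $$ (l, pick J j))"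
    unfolding submatrix_eq[OF mult_carrier_mat[OF M N] I J] using M N pick_index_sets[OF I] pick_index_sets[OF J]
    by (intro cong_mat) (auto simp: scalar_prod_def lessThan_atLeast0)
  then show ?thesis
    using submatrix_eq[OF M I] submatrix_eq[OF N _ J] by (simp add: cauchy_binet_mat)
qed

section \<open>Compounds of triangular matrices and the order of index sets\<close>

text \<open>The rows from \<open>a\<close> on and the columns up to \<open>a\<close> form a zero
  block of size k - a by a + 1. These numbers add up to more than k, so by the pigeonhole principle
  every permutation meets the block.\<close>

lemma det_submatrix_upper_triangular_eq_0:
  fixes T :: "'a :: comm_ring_1 mat"
  assumes T: "T \<in> carrier_mat n n" "upper_triangular T"
    and I: "I \<in> index_sets n k" and J: "J \<in> index_sets n k"
    and a: "a < k" "pick J a < pick I a"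
  shows "det (submatrix T I J) = 0"
proof -
  have "(\<Prod>i = 0..<k. submatrix T I J $$ (i, p i)) = 0" if p: "p permutes {0..<k}" for p
  proof -
    have "\<exists>i\<in>{a..<k}. p i \<le> a"
    proof (rule ccontr)
      assume "\<not> ?thesis"
      then have "\<forall>i\<in>{a..<k}. Suc a \<le> p i \<and> p i < k"
        using permutes_in_image[OF p] by (simp add: not_le Suc_le_eq)
      then have "p ` {a..<k} \<subseteq> {Suc a..<k}" by auto
      then have "card (p ` {a..<k}) \<le> card {Suc a..<k}" by (intro card_mono) auto
      then show False using a by (subst (asm) card_image) (auto intro: permutes_inj_on[OF p])
    qed
    then obtain i where i: "a \<le> i" "i < k" "p i \<le> a" by auto
    have "pick J (p i) \<le> pick J a" "pick I a \<le> pick I i"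
      using pick_le_pick[OF J i(3) a(1)] pick_le_pick[OF I i(1,2)] by auto
    then have "pick J (p i) < pick I i" using a by linarith
    then have "T $$ (pick I i, pick J (p i)) = 0"
      using T pick_index_sets[OF I i(2)] by auto
    then have "submatrix T I J $$ (i, p i) = 0"
      using i a submatrix_eq[OF T(1) I J] by simp
    then show ?thesis using i by (intro prod_zero) auto
  qed
  then show ?thesis by (subst det_def'[OF submatrix_carrier[OF T(1) I J]]) simp
qed

lemma det_submatrix_upper_triangular_diag:
  fixes T :: "'a :: comm_ring_1 mat"
  assumes T: "T \<in> carrier_mat n n" "upper_triangular T" and I: "I \<in> index_sets n k"
  shows "det (submatrix T I I) = (\<Prod>i\<in>I. T $$ (i, i))"
proof -
  have "upper_triangular (submatrix T I I)"
    using pick_less_pick[OF I] pick_index_sets[OF I] T(1) unfolding submatrix_eq[OF T(1) I I]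
    by (auto intro!: upper_triangularI upper_triangularD[OF T(2)])
  then have "det (submatrix T I I) = (\<Prod>i = 0..<k. T $$ (pick I i, pick I i))"
    by (subst det_upper_triangular[OF _ submatrix_carrier[OF T(1) I I]])
       (auto simp: prod_list_diag_prod submatrix_eq[OF T(1) I I])
  also have "\<dots> = (\<Prod>i\<in>I. T $$ (i, i))"
    by (rule prod.reindex_bij_betw[OF bij_betw_pick[OF I]])
  finally show ?thesis .
qed

text \<open>The element sum refines the componentwise order of index sets to a numerical one.
  Choosing an index set of least sum thus replaces an explicit ordering in which the compound of a
  triangular matrix is triangular.\<close>

lemma sum_less_of_pick_le:
  assumes I: "I \<in> index_sets n k" and J: "J \<in> index_sets n k"
    and le: "\<And>a. a < k \<Longrightarrow> pick I a \<le> pick J a" and ne: "I \<noteq> J"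
  shows "\<Sum>I < \<Sum>J"
proof -
  have s: "\<Sum>I = (\<Sum>a = 0..<k. pick I a)" "\<Sum>J = (\<Sum>a = 0..<k. pick J a)"
    using sum.reindex_bij_betw[OF bij_betw_pick[OF I], of "\<lambda>x. x"]
      sum.reindex_bij_betw[OF bij_betw_pick[OF J], of "\<lambda>x. x"] by auto
  have "\<exists>a<k. pick I a \<noteq> pick J a"
  proof (rule ccontr)
    assume "\<not> ?thesis"
    then have "pick I ` {0..<k} = pick J ` {0..<k}" by (intro image_cong) auto
    then show False using ne bij_betw_pick[OF I] bij_betw_pick[OF J] by (simp add: bij_betw_def)
  qed
  then obtain a where "a < k" "pick I a < pick J a" using le by (metis le_neq_implies_less)
  then show ?thesis unfolding s using le by (intro sum_strict_mono_ex1) auto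
qed

lemma le_pick:
  assumes I: "I \<in> index_sets n k" and a: "a < k"
  shows "a \<le> pick I a"
proof -
  have "card {i \<in> I. i < pick I a} \<le> card {..<pick I a}" by (intro card_mono) auto
  then show ?thesis using card_below_pick[OF I a] by simp
qed

lemma pick_strict_mono_image:
  assumes mono: "\<And>a b. a < b \<Longrightarrow> b < k \<Longrightarrow> f a < (f b :: nat)" and a: "a < k"
  shows "pick (f ` {0..<k}) a = f a"
proof -
  have iff: "f b < f a \<longleftrightarrow> b < a" if "b < k" for b
    using mono[of a b] mono[of b a] a that by (metis linorder_neqE_nat order_less_asym order_less_irrefl)
  then have "{i \<in> f ` {0..<k}. i < f a} = f ` {0..<a}" using a by auto
  moreover have "inj_on f {0..<a}"
    by (rule inj_onI) (metis mono a atLeastLessThan_iff linorder_neqE_nat order_less_irrefl order_less_trans)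
  ultimately have "card {i \<in> f ` {0..<k}. i < f a} = a" by (simp add: card_image)
  moreover have "f a \<in> f ` {0..<k}" using a by auto
  ultimately show ?thesis using pick_card_in_set by metis
qed

lemma image_in_index_sets:
  assumes "\<And>a b. a < b \<Longrightarrow> b < k \<Longrightarrow> f a < (f b :: nat)" "\<And>a. a < k \<Longrightarrow> f a < n"
  shows "f ` {0..<k} \<in> index_sets n k"
proof -
  have "inj_on f {0..<k}"
    by (rule inj_onI) (metis assms(1) atLeastLessThan_iff linorder_neqE_nat order_less_irrefl)
  then show ?thesis using assms(2) by (auto simp: index_sets_def card_image)
qed

text \<open>The identity and its transpose are both upper triangular, so different index sets are
  separated by the vanishing criterion in one direction or the other. With Cauchy-Binet, compounds
  of mutually inverse matrices are then mutually inverse.\<close>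

lemma det_submatrix_one:
  assumes I: "I \<in> index_sets n k" and J: "J \<in> index_sets n k"
  shows "det (submatrix (1\<^sub>m n :: 'a :: comm_ring_1 mat) I J) = (if I = J then 1 else 0)"
proof (cases "\<exists>a<k. pick J a < pick I a")
  case True
  then obtain a where a: "a < k" "pick J a < pick I a" by auto
  then have "det (submatrix (1\<^sub>m n :: 'a mat) I J) = 0"
    by (intro det_submatrix_upper_triangular_eq_0[OF _ _ I J a]) auto
  then show ?thesis using a by auto
next
  case False
  show ?thesis
  proof (cases "I = J")
    case True
    have "(\<Prod>i\<in>I. (1\<^sub>m n :: 'a mat) $$ (i, i)) = 1"
      using index_setsD(1)[OF I] by (intro prod.neutral) auto
    moreover have "upper_triangular (1\<^sub>m n :: 'a mat)" by (rule upper_triangularI) auto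
    ultimately show ?thesis
      using det_submatrix_upper_triangular_diag[OF one_carrier_mat _ I, where 'a = 'a] True by metis
  next
    case ne: False
    have "\<exists>a<k. pick I a < pick J a"
    proof (rule ccontr)
      assume "\<not> ?thesis"
      with False have "\<forall>a<k. pick I a = pick J a" by (metis linorder_neqE_nat)
      then have "pick I ` {0..<k} = pick J ` {0..<k}" by (intro image_cong) auto
      then show False using ne bij_betw_pick[OF I] bij_betw_pick[OF J] by (simp add: bij_betw_def)
    qed
    then obtain a where a: "a < k" "pick I a < pick J a" by auto
    have "det (submatrix (1\<^sub>m n :: 'a mat) J I) = 0"
      by (intro det_submatrix_upper_triangular_eq_0[OF _ _ J I a]) auto
    moreover have "submatrix (1\<^sub>m n :: 'a mat) I J = transpose_mat (submatrix (1\<^sub>m n) J I)"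
      using pick_index_sets[OF I] pick_index_sets[OF J]
      unfolding submatrix_eq[OF one_carrier_mat I J] submatrix_eq[OF one_carrier_mat J I]
      by (intro eq_matI) auto
    ultimately show ?thesis using ne det_transpose[OF submatrix_carrier[OF one_carrier_mat J I]] by metis
  qed
qed


section \<open>Perron theory of positive matrices\<close>

text \<open>
  Collatz-Wielandt: the eigenvalue is the largest \<open>r\<close> for which some point \<open>x\<close> of the simplex
  satisfies \<open>r x \<le> M x\<close>. If an inequality were strict, \<open>M x\<close> would allow a larger \<open>r\<close>.
\<close>

lemma positive_matrix_eigenvector:
  fixes M :: "'a \<Rightarrow> 'a \<Rightarrow> real"
  assumes K: "finite K" "K \<noteq> {}" and pos: "\<And>i j. i \<in> K \<Longrightarrow> j \<in> K \<Longrightarrow> 0 < M i j"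
  obtains r w where "0 < r" "\<And>i. i \<in> K \<Longrightarrow> 0 < w i" "\<And>i. i \<in> K \<Longrightarrow> (\<Sum>j\<in>K. M i j * w j) = r * w i"
proof -
  define R where "R = (\<Sum>i\<in>K. \<Sum>j\<in>K. M i j)"
  \<comment> \<open>Coordinates outside \<open>K\<close> are pinned to 0, so that Tychonoff's
    theorem on the full function space yields compactness.\<close>
  define box where "box = PiE (UNIV :: 'a set) (\<lambda>i. if i \<in> K then {0..1::real} else {0})"
  define S where "S = ({0..R} \<times> box) \<inter> {rx. (\<Sum>i\<in>K. snd rx i) = 1} \<inter>
    (\<Inter>i\<in>K. {rx. fst rx * snd rx i \<le> (\<Sum>j\<in>K. M i j * snd rx j)})"
  have "compactin (product_topology (\<lambda>_. euclidean) UNIV) box"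
    unfolding box_def compactin_PiE by auto
  then have "compact box" by (simp only: euclidean_product_topology compactin_euclidean_iff)
  then have "compact ({0..R} \<times> box)" by (intro compact_Times compact_Icc)
  moreover have c: "continuous_on UNIV (\<lambda>rx :: real \<times> ('a \<Rightarrow> real). snd rx i)" for i
    by (rule continuous_on_product_then_coordinatewise[OF continuous_on_snd[OF continuous_on_id]])
  ultimately have "compact S"
    unfolding S_def
    by (intro compact_Int_closed closed_Collect_eq closed_INT ballI closed_Collect_le continuous_intros c)
  \<comment> \<open>Summing the inequalities over \<open>K\<close> isolates r, because the entries
    of x add up to 1; each of them is at most 1, which leaves the sum of all entries of
    \<open>M\<close>.\<close>
  have Rub: "r \<le> R" if x: "\<And>i. i \<in> K \<Longrightarrow> 0 \<le> x i" "(\<Sum>i\<in>K. x i) = 1"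
    and le: "\<And>i. i \<in> K \<Longrightarrow> r * x i \<le> (\<Sum>j\<in>K. M i j * x j)" for r x
  proof -
    have x1: "x j \<le> 1" if "j \<in> K" for j
      using member_le_sum[OF that, of x] x K by auto
    have "r = (\<Sum>i\<in>K. r * x i)" by (simp add: sum_distrib_left[symmetric] x)
    also have "\<dots> \<le> (\<Sum>i\<in>K. \<Sum>j\<in>K. M i j * x j)" by (intro sum_mono le)
    also have "\<dots> \<le> R" unfolding R_def
      using pos x1 by (intro sum_mono mult_left_le) (auto simp: less_imp_le)
    finally show ?thesis .
  qed
  have inS: "(r, x) \<in> S" if x: "\<And>i. i \<in> K \<Longrightarrow> 0 \<le> x i" "\<And>i. i \<notin> K \<Longrightarrow> x i = 0" "(\<Sum>i\<in>K. x i) = 1"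
    and le: "\<And>i. i \<in> K \<Longrightarrow> r * x i \<le> (\<Sum>j\<in>K. M i j * x j)" and "0 \<le> r" for r x
  proof -
    have x1: "x j \<le> 1" if "j \<in> K" for j
      using member_le_sum[OF that, of x] x K by auto
    then show ?thesis using that Rub[of x r] by (auto simp: S_def box_def)
  qed
  have Mx: "0 < (\<Sum>j\<in>K. M i j * x j)" if x: "\<And>i. i \<in> K \<Longrightarrow> 0 \<le> x i" "j \<in> K" "0 < x j" and i: "i \<in> K" for x j i
    using K x pos[OF i] by (intro sum_pos2[of _ j]) (auto simp: less_imp_le)
  have "S \<noteq> {}"
  proof -
    define x where "x i = (if i \<in> K then 1 / real (card K) else 0)" for i
    have cK: "0 < card K" using K by (simp add: card_gt_0_iff)
    obtain i0 where "i0 \<in> K" using K by auto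
    then have "(0, x) \<in> S"
      using cK Mx[of x i0] by (intro inS) (auto simp: x_def intro!: sum_nonneg less_imp_le)
    then show ?thesis by auto
  qed
  then obtain rx where rx: "rx \<in> S" "\<And>sy. sy \<in> S \<Longrightarrow> fst sy \<le> fst rx"
    using continuous_attains_sup[OF \<open>compact S\<close> _ continuous_on_fst[OF continuous_on_id]] by auto
  obtain r x where rxe: "rx = (r, x)" by (cases rx)
  have x0: "0 \<le> x i" if "i \<in> K" for i
  proof -
    have "x \<in> box" using rx(1) unfolding rxe S_def by auto
    from PiE_mem[OF this[unfolded box_def], of i] show ?thesis using that by simp
  qed
  have x1: "(\<Sum>i\<in>K. x i) = 1" and xle: "\<And>i. i \<in> K \<Longrightarrow> r * x i \<le> (\<Sum>j\<in>K. M i j * x j)" and r0: "0 \<le> r"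
    using rx(1) unfolding rxe S_def box_def by auto
  define u where "u i = (\<Sum>j\<in>K. M i j * x j)" for i
  have "\<exists>j\<in>K. 0 < x j"
    using x0 x1 by (metis less_eq_real_def sum.neutral zero_neq_one)
  then have u0: "0 < u i" if "i \<in> K" for i using Mx[of x] x0 that unfolding u_def by blast
  have eq: "u i = r * x i" if i: "i \<in> K" for i
  proof (rule ccontr)
    assume "u i \<noteq> r * x i"
    then have lt: "r * x i < u i" using xle[OF i] by (simp add: u_def)
    \<comment> \<open>The vector \<open>u - r x\<close> is nonnegative and nonzero, and applying the
      positive matrix \<open>M\<close> to it makes every entry positive.\<close>
    have strict: "r * u l < (\<Sum>j\<in>K. M l j * u j)" if l: "l \<in> K" for l
    proof -
      have "r * u l = (\<Sum>j\<in>K. M l j * (r * x j))" by (simp add: u_def sum_distrib_left algebra_simps)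
      also have "\<dots> < (\<Sum>j\<in>K. M l j * u j)"
        using K lt i xle pos[OF l] by (intro sum_strict_mono_ex1) (auto simp: u_def less_imp_le)
      finally show ?thesis .
    qed
    define q where "q l = (\<Sum>j\<in>K. M l j * u j) / u l" for l
    \<comment> \<open>The least quotient over the finite set \<open>K\<close> still exceeds r, so
      \<open>u\<close>, scaled back to the simplex, beats the maximiser.\<close>
    define r' where "r' = Min (q ` K)"
    have r': "r < r'" unfolding r'_def
      using K strict u0 by (subst Min_gr_iff) (auto simp: q_def pos_less_divide_eq)
    have r'u: "r' * u l \<le> (\<Sum>j\<in>K. M l j * u j)" if "l \<in> K" for l
    proof -
      have "r' \<le> q l" unfolding r'_def using K that by (intro Min_le) auto
      then show ?thesis using u0[OF that] by (simp add: q_def pos_le_divide_eq)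
    qed
    define s where "s = (\<Sum>j\<in>K. u j)"
    have s0: "0 < s" unfolding s_def using K u0 by (intro sum_pos) auto
    define y where "y i = (if i \<in> K then u i / s else 0)" for i
    have "(r', y) \<in> S"
    proof (rule inS)
      show "(\<Sum>i\<in>K. y i) = 1" using s0 by (simp add: y_def sum_divide_distrib[symmetric] s_def)
      show "r' * y l \<le> (\<Sum>j\<in>K. M l j * y j)" if "l \<in> K" for l
        using divide_right_mono[OF r'u[OF that], of s] s0 that by (simp add: y_def sum_divide_distrib)
    qed (use u0 s0 r' r0 in \<open>auto simp: y_def intro!: less_imp_le\<close>)
    then show False using rx(2)[of "(r', y)"] r' by (simp add: rxe)
  qed
  have "r > 0"
  proof -
    obtain i where "i \<in> K" using K by auto
    then show ?thesis using eq u0 r0 by (metis less_eq_real_def mult_zero_left order_less_irrefl)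
  qed
  moreover have "0 < x i" if "i \<in> K" for i
    using eq[OF that] u0[OF that] \<open>r > 0\<close> by (simp add: zero_less_mult_iff)
  ultimately show ?thesis using that[of r x] eq by (simp add: u_def)
qed

text \<open>Rotate the sum onto the nonnegative real axis. Each rotated term has real part at most
  its modulus, and equality of the weighted totals forces equality termwise.\<close>

lemma norm_sum_eq_imp_common_phase:
  fixes z :: "'a \<Rightarrow> complex"
  assumes K: "finite K" "K \<noteq> {}" and a: "\<And>j. j \<in> K \<Longrightarrow> 0 < a j"
    and eq: "cmod (\<Sum>j\<in>K. complex_of_real (a j) * z j) = (\<Sum>j\<in>K. a j * cmod (z j))"
  obtains \<theta> where "cmod \<theta> = 1" "\<And>j. j \<in> K \<Longrightarrow> z j = \<theta> * complex_of_real (cmod (z j))"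
proof -
  define s where "s = (\<Sum>j\<in>K. complex_of_real (a j) * z j)"
  \<comment> \<open>If the sum is 0, the hypothesis makes every \<open>z j\<close> vanish and any
    unit serves.\<close>
  define \<theta> where "\<theta> = (if s = 0 then 1 else sgn s)"
  have n\<theta>: "cmod \<theta> = 1" by (simp add: \<theta>_def norm_sgn)
  have "s = \<theta> * cmod s" by (simp add: \<theta>_def sgn_div_norm scaleR_conv_of_real)
  then have "cnj \<theta> * s = (cnj \<theta> * \<theta>) * cmod s" by (simp add: mult.assoc)
  also have "cnj \<theta> * \<theta> = 1" using n\<theta> by (simp add: mult.commute complex_norm_square[symmetric])
  finally have "cnj \<theta> * s = cmod s" by simp
  then have "Re (cnj \<theta> * s) = cmod s" by simp
  moreover have "Re (cnj \<theta> * s) = (\<Sum>j\<in>K. a j * Re (cnj \<theta> * z j))"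
    by (simp add: s_def sum_distrib_left algebra_simps sum.distrib sum_subtractf)
  ultimately have sum0: "(\<Sum>j\<in>K. a j * (cmod (z j) - Re (cnj \<theta> * z j))) = 0"
    using eq by (simp add: s_def algebra_simps sum_subtractf)
  have nn: "Re (cnj \<theta> * z j) \<le> cmod (z j)" for j
    using complex_Re_le_cmod[of "cnj \<theta> * z j"] n\<theta> by (simp add: norm_mult)
  have "z j = \<theta> * complex_of_real (cmod (z j))" if j: "j \<in> K" for j
  proof -
    have "a j * (cmod (z j) - Re (cnj \<theta> * z j)) = 0"
      using sum_nonneg_0[OF K(1) _ sum0 j] nn a by (simp add: less_imp_le)
    then have Re: "Re (cnj \<theta> * z j) = cmod (cnj \<theta> * z j)"
      using a[OF j] n\<theta> by (simp add: norm_mult)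
    moreover from this have "Im (cnj \<theta> * z j) = 0"
      using cmod_power2[of "cnj \<theta> * z j"] by simp
    ultimately have "cnj \<theta> * z j = complex_of_real (cmod (cnj \<theta> * z j))"
      by (intro complex_eqI) (simp_all only: Re_complex_of_real Im_complex_of_real)
    then have "\<theta> * (cnj \<theta> * z j) = \<theta> * complex_of_real (cmod (z j))"
      using n\<theta> by (simp add: norm_mult)
    then show ?thesis using n\<theta> by (simp add: mult.assoc[symmetric] complex_norm_square[symmetric])
  qed
  then show ?thesis using that n\<theta> by blast
qed

text \<open>The triangle inequality bounds |\<mu>| |z| by M |z| entrywise. Pairing with the positive
  left eigenvector \<open>w\<close> leaves no slack once r \<le> |\<mu>|, so every row is an
  equality. One such row fixes a common phase, and positivity of M |z| excludes zero
  entries.\<close>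

lemma positive_matrix_dominant_eigenvector:
  fixes M :: "'a \<Rightarrow> 'a \<Rightarrow> real" and z :: "'a \<Rightarrow> complex"
  assumes K: "finite K" "K \<noteq> {}" and pos: "\<And>i j. i \<in> K \<Longrightarrow> j \<in> K \<Longrightarrow> 0 < M i j"
    and w: "\<And>i. i \<in> K \<Longrightarrow> 0 < w i" "\<And>j. j \<in> K \<Longrightarrow> (\<Sum>i\<in>K. w i * M i j) = r * w j"
    and z: "\<And>i. i \<in> K \<Longrightarrow> (\<Sum>j\<in>K. complex_of_real (M i j) * z j) = \<mu> * z i" "\<exists>i\<in>K. z i \<noteq> 0"
    and \<mu>: "r \<le> cmod \<mu>"
  obtains \<theta> x where "\<mu> = complex_of_real r" "cmod \<theta> = 1"
    "\<And>i. i \<in> K \<Longrightarrow> z i = \<theta> * complex_of_real (x i)" "\<And>i. i \<in> K \<Longrightarrow> 0 < x i"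
proof -
  have le: "cmod \<mu> * cmod (z i) \<le> (\<Sum>j\<in>K. M i j * cmod (z j))" if i: "i \<in> K" for i
  proof -
    have "cmod \<mu> * cmod (z i) = cmod (\<Sum>j\<in>K. complex_of_real (M i j) * z j)"
      by (simp add: z(1)[OF i] norm_mult)
    also have "\<dots> \<le> (\<Sum>j\<in>K. cmod (complex_of_real (M i j) * z j))" by (rule norm_sum)
    also have "\<dots> = (\<Sum>j\<in>K. M i j * cmod (z j))"
      using pos[OF i] by (intro sum.cong) (auto simp: norm_mult less_imp_le)
    finally show ?thesis .
  qed
  have swap: "(\<Sum>i\<in>K. w i * (\<Sum>j\<in>K. M i j * cmod (z j))) = r * (\<Sum>j\<in>K. w j * cmod (z j))"
  proof -
    have "(\<Sum>i\<in>K. w i * (\<Sum>j\<in>K. M i j * cmod (z j))) = (\<Sum>j\<in>K. (\<Sum>i\<in>K. w i * M i j) * cmod (z j))"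
      unfolding sum_distrib_left sum_distrib_right by (subst sum.swap) (simp add: mult.assoc)
    also have "\<dots> = (\<Sum>j\<in>K. r * w j * cmod (z j))" using w(2) by (intro sum.cong) auto
    finally show ?thesis by (simp add: sum_distrib_left mult.assoc)
  qed
  have "0 \<le> (\<Sum>j\<in>K. w j * cmod (z j))" using w(1) by (intro sum_nonneg) (auto simp: less_imp_le)
  then have "(\<Sum>i\<in>K. w i * ((\<Sum>j\<in>K. M i j * cmod (z j)) - cmod \<mu> * cmod (z i))) \<le> 0"
    using mult_right_mono[OF \<mu>, of "\<Sum>j\<in>K. w j * cmod (z j)"] swap
    by (simp add: right_diff_distrib sum_subtractf sum_distrib_left mult.left_commute)
  moreover have nn: "0 \<le> w i * ((\<Sum>j\<in>K. M i j * cmod (z j)) - cmod \<mu> * cmod (z i))" if "i \<in> K" for i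
    using le[OF that] w(1)[OF that] by simp
  ultimately have sum0: "(\<Sum>i\<in>K. w i * ((\<Sum>j\<in>K. M i j * cmod (z j)) - cmod \<mu> * cmod (z i))) = 0"
    by (intro antisym sum_nonneg)
  have eq: "(\<Sum>j\<in>K. M i j * cmod (z j)) = cmod \<mu> * cmod (z i)" if i: "i \<in> K" for i
    using sum_nonneg_0[OF K(1) nn sum0 i] w(1)[OF i] by simp
  obtain i0 where i0: "i0 \<in> K" "z i0 \<noteq> 0" using z(2) by auto
  have "cmod (\<Sum>j\<in>K. complex_of_real (M i0 j) * z j) = (\<Sum>j\<in>K. M i0 j * cmod (z j))"
    by (simp add: z(1)[OF i0(1)] eq[OF i0(1)] norm_mult)
  then obtain \<theta> where \<theta>: "cmod \<theta> = 1" "\<And>j. j \<in> K \<Longrightarrow> z j = \<theta> * complex_of_real (cmod (z j))"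
    using norm_sum_eq_imp_common_phase[where a = "M i0", OF K pos[OF i0(1)]] by blast
  have Mz: "0 < (\<Sum>j\<in>K. M i j * cmod (z j))" if i: "i \<in> K" for i
    using K i0 pos[OF i] by (intro sum_pos2[of _ i0]) (auto simp: less_imp_le)
  have nz: "z i \<noteq> 0" if "i \<in> K" for i
    using Mz[OF that] eq[OF that] by auto
  have "\<mu> * z i0 = (\<Sum>j\<in>K. complex_of_real (M i0 j) * (\<theta> * complex_of_real (cmod (z j))))"
    unfolding z(1)[OF i0(1), symmetric] by (intro sum.cong refl arg_cong2[where f = "(*)"] \<theta>(2))
  also have "\<dots> = \<theta> * complex_of_real (\<Sum>j\<in>K. M i0 j * cmod (z j))"
    by (simp add: sum_distrib_left mult.left_commute)
  also have "\<dots> = cmod \<mu> * (\<theta> * complex_of_real (cmod (z i0)))"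
    by (simp add: eq[OF i0(1)] mult.left_commute)
  also have "\<theta> * complex_of_real (cmod (z i0)) = z i0" by (rule \<theta>(2)[OF i0(1), symmetric])
  finally have \<mu>': "\<mu> = cmod \<mu>" using i0 by simp
  have "(\<Sum>i\<in>K. w i * (\<Sum>j\<in>K. M i j * cmod (z j))) = cmod \<mu> * (\<Sum>j\<in>K. w j * cmod (z j))"
    using eq by (simp add: sum_distrib_left mult.left_commute)
  moreover have "0 < (\<Sum>j\<in>K. w j * cmod (z j))" using K w(1) nz by (intro sum_pos) auto
  ultimately have "cmod \<mu> = r" using swap by simp
  then have "\<mu> = complex_of_real r" using \<mu>' by (simp only:)
  moreover have "0 < cmod (z i)" if "i \<in> K" for i using nz[OF that] by simp
  ultimately show ?thesis using that[OF _ \<theta>] by blast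
qed


section \<open>The dominant eigenvalue of the compound matrix\<close>

lemma index_sets_initial:
  assumes "k \<le> n"
  shows "{0..<k} \<in> index_sets n k" "\<And>a. a < k \<Longrightarrow> pick {0..<k} a = a"
proof -
  show "{0..<k} \<in> index_sets n k" using assms by (auto simp: index_sets_def)
  show "pick {0..<k} a = a" if "a < k" for a
    using pick_strict_mono_image[of k "\<lambda>a. a" a] that by simp
qed

text \<open>This index set is the immediate successor of the initial one; its diagonal product has
  the (k+1)-st eigenvalue in place of the k-th.\<close>

lemma index_sets_initial_skip:
  assumes "0 < k" "k < n"
  shows "insert k {0..<k - 1} \<in> index_sets n k"
    "\<And>a. a < k \<Longrightarrow> pick (insert k {0..<k - 1}) a = (if a = k - 1 then k else a)"
proof -
  let ?f = "\<lambda>a. if a = k - 1 then k else a"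
  have im: "?f ` {0..<k} = insert k {0..<k - 1}" using assms(1) by (force simp: image_iff)
  show "insert k {0..<k - 1} \<in> index_sets n k"
    using image_in_index_sets[of k ?f n] assms(2) unfolding im by simp
  show "pick (insert k {0..<k - 1}) a = ?f a" if "a < k" for a
    using pick_strict_mono_image[of k ?f a] that unfolding im by simp
qed

lemma index_set_eq_pick_image:
  assumes "I \<in> index_sets n k"
  shows "I = pick I ` {0..<k}"
  using bij_betw_pick[OF assms] by (simp add: bij_betw_def)

lemma det_submatrix_of_real:
  fixes A :: "real mat"
  assumes "A \<in> carrier_mat n n" "I \<in> index_sets n k" "J \<in> index_sets n k"
  shows "det (submatrix (map_mat complex_of_real A) I J) = complex_of_real (det (submatrix A I J))"
proof -
  have "submatrix (map_mat complex_of_real A) I J = map_mat complex_of_real (submatrix A I J)"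
    unfolding submatrix_eq[OF assms] submatrix_eq[OF iffD2[OF map_carrier_mat assms(1)] assms(2,3)]
    using pick_index_sets[OF assms(2)] pick_index_sets[OF assms(3)] assms(1) by (intro eq_matI) auto
  then show ?thesis by simp
qed

text \<open>
  The compound of \<open>P\<close> triangularises the compound of \<open>A\<close>, which by hypothesis is \<open>\<epsilon>\<close> times
  a positive matrix. Its dominant eigenvalue is therefore the diagonal product over \<open>{0..<k}\<close>.
\<close>

lemma compound_perron:
  fixes A :: "real mat" and P Q T :: "complex mat" and \<epsilon> :: real
  assumes A: "A \<in> carrier_mat n n" and k: "0 < k" "k < n" and \<epsilon>: "\<epsilon> \<in> {-1, 1}"
    and pos: "\<And>I J. I \<in> index_sets n k \<Longrightarrow> J \<in> index_sets n k \<Longrightarrow> 0 < \<epsilon> * det (submatrix A I J)"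
    and P: "P \<in> carrier_mat n n" and Q: "Q \<in> carrier_mat n n" and T: "T \<in> carrier_mat n n"
    and PQ: "P * Q = 1\<^sub>m n" and QP: "Q * P = 1\<^sub>m n" and ut: "upper_triangular T"
    and AP: "map_mat complex_of_real A * P = P * T"
    and dec: "\<And>i j. i \<le> j \<Longrightarrow> j < n \<Longrightarrow> cmod (T $$ (j, j)) \<le> cmod (T $$ (i, i))"
  obtains r \<theta> x where "0 < r" "complex_of_real \<epsilon> * (\<Prod>i = 0..<k. T $$ (i, i)) = complex_of_real r"
    "cmod (T $$ (k, k)) < cmod (T $$ (k - 1, k - 1))" "cmod \<theta> = 1"
    "\<And>I. I \<in> index_sets n k \<Longrightarrow> det (submatrix P I {0..<k}) = \<theta> * complex_of_real (x I)"
    "\<And>I. I \<in> index_sets n k \<Longrightarrow> 0 < x I"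
proof -
  let ?K = "index_sets n k"
  let ?S0 = "{0..<k}" and ?S1 = "insert k {0..<k - 1}"
  define C where "C M I J = det (submatrix M I J)" for M :: "complex mat" and I J
  define M where "M I J = \<epsilon> * det (submatrix A I J)" for I J
  define \<mu> where "\<mu> S = (\<Prod>i\<in>S. T $$ (i, i))" for S
  let ?e = "complex_of_real \<epsilon>"
  have e2: "?e * ?e = 1" "cmod ?e = 1" using \<epsilon> by auto
  note S0 = index_sets_initial[OF less_imp_le[OF k(2)]] and S1 = index_sets_initial_skip[OF k]
  have fK: "finite ?K" "?K \<noteq> {}" using finite_index_sets S0(1) by auto
  have CC: "C (X * Y) I J = (\<Sum>L\<in>?K. C X I L * C Y L J)"
    if "X \<in> carrier_mat n n" "Y \<in> carrier_mat n n" "I \<in> ?K" "J \<in> ?K" for X Y I J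
    unfolding C_def by (rule cauchy_binet[OF that])
  have C1: "C (1\<^sub>m n) I J = (if I = J then 1 else 0)" if "I \<in> ?K" "J \<in> ?K" for I J
    unfolding C_def by (rule det_submatrix_one[OF that])
  have CT: "pick I a \<le> pick J a" if "I \<in> ?K" "J \<in> ?K" "C T I J \<noteq> 0" "a < k" for I J a
    using det_submatrix_upper_triangular_eq_0[OF T ut that(1,2,4)] that(3) unfolding C_def by force
  have CTd: "C T I I = \<mu> I" if "I \<in> ?K" for I
    unfolding C_def \<mu>_def by (rule det_submatrix_upper_triangular_diag[OF T ut that])
  have CTsum: "\<Sum>I < \<Sum>J" if "I \<in> ?K" "J \<in> ?K" "C T I J \<noteq> 0" "I \<noteq> J" for I J
    using sum_less_of_pick_le[OF that(1,2) CT[OF that(1,2,3)] that(4)] by simp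
  have CA: "?e * C (map_mat complex_of_real A) I J = complex_of_real (M I J)" if "I \<in> ?K" "J \<in> ?K" for I J
    unfolding C_def M_def det_submatrix_of_real[OF A that] by simp
  have Mpos: "0 < M I J" if "I \<in> ?K" "J \<in> ?K" for I J
    unfolding M_def by (rule pos[OF that])
  have MP: "(\<Sum>J\<in>?K. complex_of_real (M I J) * C P J S) = ?e * (\<Sum>L\<in>?K. C P I L * C T L S)"
    if I: "I \<in> ?K" and S: "S \<in> ?K" for I S
  proof -
    have "(\<Sum>J\<in>?K. complex_of_real (M I J) * C P J S) = ?e * C (map_mat complex_of_real A * P) I S"
      using CC[OF iffD2[OF map_carrier_mat A] P I S] by (simp add: sum_distrib_left CA[OF I, symmetric] mult.assoc)
    then show ?thesis unfolding AP CC[OF P T I S] .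
  qed
  have PQsum: "(\<Sum>L\<in>?K. C P I L * C Q L J) = (if I = J then 1 else 0)" if "I \<in> ?K" "J \<in> ?K" for I J
    using CC[OF P Q that] C1[OF that] by (simp add: PQ)
  have QPsum: "(\<Sum>L\<in>?K. C Q I L * C P L J) = (if I = J then 1 else 0)" if "I \<in> ?K" "J \<in> ?K" for I J
    using CC[OF Q P that] C1[OF that] by (simp add: QP)
  \<comment> \<open>Perron's theorem is applied to the transpose, since a left eigenvector is
    wanted.\<close>
  have "0 < M J I" if "I \<in> ?K" "J \<in> ?K" for I J
    using Mpos[OF that(2,1)] .
  from positive_matrix_eigenvector[where M = "\<lambda>J I. M I J", OF fK this]
  obtain r w where r: "0 < r" and w: "\<And>I. I \<in> ?K \<Longrightarrow> 0 < w I"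
    and wM: "\<And>J. J \<in> ?K \<Longrightarrow> (\<Sum>I\<in>?K. M I J * w I) = r * w J"
    by blast
  have wM': "(\<Sum>I\<in>?K. w I * M I J) = r * w J" if "J \<in> ?K" for J
    using wM[OF that] by (simp add: mult.commute)
  have \<mu>_le: "cmod (\<mu> S) \<le> cmod (\<mu> ?S0)" if S: "S \<in> ?K" for S
  proof -
    have "\<mu> S = (\<Prod>a = 0..<k. T $$ (pick S a, pick S a))"
      unfolding \<mu>_def by (rule prod.reindex_bij_betw[OF bij_betw_pick[OF S], symmetric])
    then have "cmod (\<mu> S) = (\<Prod>a = 0..<k. cmod (T $$ (pick S a, pick S a)))" by (simp add: prod_norm)
    also have "\<dots> \<le> (\<Prod>a = 0..<k. cmod (T $$ (a, a)))"
      using le_pick[OF S] pick_index_sets[OF S] by (intro prod_mono) (auto intro: dec)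
    finally show ?thesis by (simp add: \<mu>_def prod_norm)
  qed
  \<comment> \<open>Nothing yet relates \<open>r\<close> to the diagonal of \<open>T\<close>.
    Transporting \<open>w\<close> along the compound of \<open>P\<close> gives a left eigenvector of
    the compound of \<open>T\<close> for \<open>?e * r\<close>, and by triangularity this number is
    one of the diagonal products.\<close>
  have r_le: "r \<le> cmod (\<mu> ?S0)"
  proof -
    define y where "y J = (\<Sum>I\<in>?K. complex_of_real (w I) * C P I J)" for J
    have yT: "(\<Sum>L\<in>?K. y L * C T L J) = ?e * r * y J" if J: "J \<in> ?K" for J
    proof -
      have "?e * (\<Sum>L\<in>?K. y L * C T L J) = (\<Sum>I\<in>?K. complex_of_real (w I) * (?e * (\<Sum>L\<in>?K. C P I L * C T L J)))"
        unfolding y_def sum_distrib_right sum_distrib_left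
        by (subst sum.swap) (simp add: mult_ac)
      also have "\<dots> = (\<Sum>I\<in>?K. complex_of_real (w I) * (\<Sum>L\<in>?K. complex_of_real (M I L) * C P L J))"
        by (intro sum.cong refl) (simp add: MP[OF _ J])
      also have "\<dots> = (\<Sum>L\<in>?K. complex_of_real (\<Sum>I\<in>?K. w I * M I L) * C P L J)"
        unfolding sum_distrib_left of_real_sum sum_distrib_right by (subst sum.swap) (simp add: mult_ac)
      also have "\<dots> = r * y J"
        unfolding y_def sum_distrib_left by (intro sum.cong refl) (simp add: wM')
      finally have "?e * (?e * (\<Sum>L\<in>?K. y L * C T L J)) = ?e * (r * y J)" by simp
      then show ?thesis by (simp only: mult.assoc[symmetric] e2 mult_1_left)
    qed
    \<comment> \<open>The compound of \<open>Q\<close> turns \<open>y\<close> back into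
      \<open>w\<close>, which has no zero entry.\<close>
    have "\<exists>J\<in>?K. y J \<noteq> 0"
    proof (rule ccontr)
      assume "\<not> ?thesis"
      then have "0 = (\<Sum>L\<in>?K. y L * C Q L ?S0)" by simp
      also have "\<dots> = (\<Sum>I\<in>?K. complex_of_real (w I) * (\<Sum>L\<in>?K. C P I L * C Q L ?S0))"
        unfolding y_def sum_distrib_right sum_distrib_left by (subst sum.swap) (simp add: mult_ac)
      also have "\<dots> = (\<Sum>I\<in>?K. if I = ?S0 then complex_of_real (w I) else 0)"
        using S0(1) by (intro sum.cong refl) (simp add: PQsum)
      also have "\<dots> = w ?S0" using S0(1) fK by (simp add: sum.delta)
      finally show False using w[OF S0(1)] by simp
    qed
    \<comment> \<open>At a support element of least sum the off-diagonal terms of the eigenvector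
      equation drop out, because each would need a support element of smaller sum.\<close>
    then obtain J where J: "J \<in> ?K" "y J \<noteq> 0" and min: "\<And>L. L \<in> ?K \<Longrightarrow> y L \<noteq> 0 \<Longrightarrow> \<Sum>J \<le> \<Sum>L"
      using ex_has_least_nat[of "\<lambda>J. J \<in> ?K \<and> y J \<noteq> 0" _ "\<lambda>J. \<Sum>J"] by blast
    have "?e * r * y J = (\<Sum>L\<in>?K. if L = J then y J * \<mu> J else 0)"
      unfolding yT[OF J(1), symmetric]
    proof (intro sum.cong refl)
      fix L assume L: "L \<in> ?K"
      have "y L * C T L J = 0" if "L \<noteq> J"
        using CTsum[OF L J(1) _ that] min[OF L] by (metis mult_eq_0_iff not_less)
      then show "y L * C T L J = (if L = J then y J * \<mu> J else 0)" using CTd[OF L] by (cases "L = J") simp_all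
    qed
    also have "\<dots> = y J * \<mu> J" using J(1) fK by (simp add: sum.delta)
    finally have "?e * r = \<mu> J" using J(2) by simp
    then have "cmod (\<mu> J) = r" using e2 r by (metis abs_of_pos norm_mult norm_of_real mult_1_left)
    then show ?thesis using \<mu>_le[OF J(1)] by simp
  qed
  have dom: "\<nu> = complex_of_real r \<and> (\<exists>\<theta> x. cmod \<theta> = 1 \<and> (\<forall>I\<in>?K. y I = \<theta> * complex_of_real (x I)) \<and> (\<forall>I\<in>?K. 0 < x I))"
    if "\<And>I. I \<in> ?K \<Longrightarrow> (\<Sum>J\<in>?K. complex_of_real (M I J) * y J) = \<nu> * y I" "\<exists>I\<in>?K. y I \<noteq> 0" "r \<le> cmod \<nu>" for y \<nu>
    by (rule positive_matrix_dominant_eigenvector[where M = M, OF fK Mpos w wM' that]) blast+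
  \<comment> \<open>\<open>z\<close> is an eigenvector of \<open>M\<close>. Only \<open>?S0\<close>
    lies strictly below \<open>?S1\<close> componentwise, so \<open>z\<close> and \<open>z'\<close>
    span an invariant plane, on which \<open>M\<close> acts up to \<open>?e\<close> as a triangular
    matrix with diagonal \<open>\<mu> ?S0\<close>, \<open>\<mu> ?S1\<close> and corner
    \<open>c\<close>.\<close>
  define z where "z I = C P I ?S0" for I
  define z' where "z' I = C P I ?S1" for I
  define c where "c = C T ?S0 ?S1"
  have S01: "?S0 \<noteq> ?S1" by auto
  have Mz: "(\<Sum>J\<in>?K. complex_of_real (M I J) * z J) = ?e * \<mu> ?S0 * z I" if I: "I \<in> ?K" for I
  proof -
    have "(\<Sum>L\<in>?K. C P I L * C T L ?S0) = (\<Sum>L\<in>?K. if L = ?S0 then z I * \<mu> ?S0 else 0)"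
    proof (intro sum.cong refl)
      fix L assume L: "L \<in> ?K"
      have "C T L ?S0 = 0" if "L \<noteq> ?S0"
      proof (rule ccontr)
        assume nz: "C T L ?S0 \<noteq> 0"
        have "pick L a = a" if a: "a < k" for a
          using CT[OF L S0(1) nz a] le_pick[OF L a] S0(2)[OF a] by simp
        then have "pick L ` {0..<k} = {0..<k}" by simp
        then show False using index_set_eq_pick_image[OF L] that by simp
      qed
      then show "C P I L * C T L ?S0 = (if L = ?S0 then z I * \<mu> ?S0 else 0)"
        using CTd[OF S0(1)] by (simp add: z_def)
    qed
    also have "\<dots> = z I * \<mu> ?S0" using S0(1) fK by (simp add: sum.delta)
    finally show ?thesis using MP[OF I S0(1)] by (simp add: z_def mult_ac)
  qed
  have Mz': "(\<Sum>J\<in>?K. complex_of_real (M I J) * z' J) = ?e * (c * z I + \<mu> ?S1 * z' I)" if I: "I \<in> ?K" for I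
  proof -
    have "(\<Sum>L\<in>?K. C P I L * C T L ?S1) = (\<Sum>L\<in>?K. (if L = ?S0 then c * z I else 0) + (if L = ?S1 then z' I * \<mu> ?S1 else 0))"
    proof (intro sum.cong refl)
      fix L assume L: "L \<in> ?K"
      have "C T L ?S1 = 0" if ne: "L \<noteq> ?S0" "L \<noteq> ?S1"
      proof (rule ccontr)
        assume nz: "C T L ?S1 \<noteq> 0"
        \<comment> \<open>Each entry of \<open>L\<close> is squeezed between \<open>a\<close> and
          \<open>pick ?S1 a\<close>, and these differ only in the last place.\<close>
        have p: "pick L a = a \<or> a = k - 1 \<and> pick L a = k" if a: "a < k" for a
          using CT[OF L S1(1) nz a] le_pick[OF L a] S1(2)[OF a] by (auto split: if_splits)
        show False
        proof (cases "pick L (k - 1) = k")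
          case True
          then have "\<forall>a\<in>{0..<k}. pick L a = pick ?S1 a"
            using p S1(2) by (metis atLeastLessThan_iff)
          then have "pick L ` {0..<k} = pick ?S1 ` {0..<k}" by (intro image_cong) auto
          then show False using ne(2) index_set_eq_pick_image[OF L] index_set_eq_pick_image[OF S1(1)] by metis
        next
          case False
          then have "\<forall>a\<in>{0..<k}. pick L a = a" using p by (metis atLeastLessThan_iff)
          then have "pick L ` {0..<k} = {0..<k}" by simp
          then show False using ne(1) index_set_eq_pick_image[OF L] by metis
        qed
      qed
      then show "C P I L * C T L ?S1 = (if L = ?S0 then c * z I else 0) + (if L = ?S1 then z' I * \<mu> ?S1 else 0)"
        using CTd[OF S1(1)] S01 by (auto simp: z_def z'_def c_def)
    qed
    also have "\<dots> = c * z I + z' I * \<mu> ?S1"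
      using S0(1) S1(1) fK by (simp add: sum.distrib sum.delta)
    finally show ?thesis using MP[OF I S1(1)] by (simp add: z'_def mult_ac)
  qed
  \<comment> \<open>Row \<open>?S1\<close> of the compound of \<open>Q\<close> sends
    \<open>z\<close> to 0 and \<open>z'\<close> to 1.\<close>
  have indep: "\<exists>I\<in>?K. z' I - s * z I \<noteq> 0" for s
  proof (rule ccontr)
    assume "\<not> ?thesis"
    then have "(\<Sum>I\<in>?K. C Q ?S1 I * (z' I - s * z I)) = 0" by simp
    moreover have "(\<Sum>I\<in>?K. C Q ?S1 I * (z' I - s * z I)) =
        (\<Sum>I\<in>?K. C Q ?S1 I * z' I) - s * (\<Sum>I\<in>?K. C Q ?S1 I * z I)"
      unfolding sum_distrib_left sum_subtractf[symmetric] by (intro sum.cong refl) (simp add: algebra_simps)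
    ultimately show False
      using QPsum[OF S1(1) S1(1)] QPsum[OF S1(1) S0(1)] S01 unfolding z_def z'_def by (auto split: if_splits)
  qed
  have "\<exists>I\<in>?K. z I \<noteq> 0"
  proof (rule ccontr)
    assume "\<not> ?thesis"
    then have "(\<Sum>I\<in>?K. C Q ?S0 I * z I) = 0" by simp
    then show False using QPsum[OF S0(1) S0(1)] by (simp add: z_def)
  qed
  from dom[OF Mz this] r_le e2 obtain \<theta> x where \<mu>r: "?e * \<mu> ?S0 = complex_of_real r" and \<theta>: "cmod \<theta> = 1"
    and zx: "\<And>I. I \<in> ?K \<Longrightarrow> z I = \<theta> * complex_of_real (x I)" and x: "\<And>I. I \<in> ?K \<Longrightarrow> 0 < x I"
    by (auto simp: norm_mult)
  have "cmod (T $$ (k, k)) < cmod (T $$ (k - 1, k - 1))"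
  proof (rule ccontr)
    assume "\<not> ?thesis"
    then have eq: "cmod (T $$ (k, k)) = cmod (T $$ (k - 1, k - 1))" using dec[of "k - 1" k] k by simp
    have "\<mu> ?S1 = T $$ (k, k) * (\<Prod>i = 0..<k - 1. T $$ (i, i))" unfolding \<mu>_def by simp
    moreover have "\<mu> ?S0 = T $$ (k - 1, k - 1) * (\<Prod>i = 0..<k - 1. T $$ (i, i))"
      unfolding \<mu>_def using k(1) prod.atLeast0_lessThan_Suc[of "\<lambda>i. T $$ (i, i)" "k - 1"] by (simp add: mult.commute)
    ultimately have n1: "cmod (\<mu> ?S1) = cmod (\<mu> ?S0)" by (simp add: norm_mult eq)
    show False
    proof (cases "\<mu> ?S1 = \<mu> ?S0")
      case False
      \<comment> \<open>This shift diagonalises the triangular action: \<open>z' - s * z\<close> is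
        an eigenvector for \<open>\<mu> ?S1\<close>. Having dominant modulus, its eigenvalue would
        have to coincide with that of \<open>z\<close>.\<close>
      define s where "s = - c / (\<mu> ?S1 - \<mu> ?S0)"
      have "c = - (s * (\<mu> ?S1 - \<mu> ?S0))" using False by (simp add: s_def)
      then have s: "c = - s * \<mu> ?S1 + s * \<mu> ?S0" by (simp add: algebra_simps)
      have "(\<Sum>J\<in>?K. complex_of_real (M I J) * (z' J - s * z J)) = ?e * \<mu> ?S1 * (z' I - s * z I)"
        if I: "I \<in> ?K" for I
      proof -
        have "(\<Sum>J\<in>?K. complex_of_real (M I J) * (z' J - s * z J)) =
            ?e * (c * z I + \<mu> ?S1 * z' I) - s * (?e * \<mu> ?S0 * z I)"
          unfolding Mz[OF I, symmetric] Mz'[OF I, symmetric]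
          unfolding sum_distrib_left sum_subtractf[symmetric] by (intro sum.cong refl) (simp add: algebra_simps)
        also have "\<dots> = ?e * \<mu> ?S1 * (z' I - s * z I)" unfolding s by (simp add: algebra_simps)
        finally show ?thesis .
      qed
      from dom[OF this indep] have "?e * \<mu> ?S1 = ?e * \<mu> ?S0"
        using n1 r_le e2 \<mu>r by (simp add: norm_mult)
      then show False using False e2 by (metis mult.assoc mult_1_left)
    next
      case True
      \<comment> \<open>\<open>w\<close> is positive and \<open>z\<close> is positive up to a unit,
        so they do not pair to 0. Pairing the equation for \<open>z'\<close> with \<open>w\<close>
        then forces \<open>c = 0\<close>, which rules out a Jordan block.\<close>
      have wz: "(\<Sum>I\<in>?K. complex_of_real (w I) * z I) \<noteq> 0"
      proof -
        have "(\<Sum>I\<in>?K. complex_of_real (w I) * z I) = \<theta> * complex_of_real (\<Sum>I\<in>?K. w I * x I)"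
          unfolding of_real_sum sum_distrib_left by (intro sum.cong refl) (simp add: zx)
        moreover have "(\<Sum>I\<in>?K. w I * x I) \<noteq> 0"
          using fK w x by (intro less_imp_neq[symmetric] sum_pos) auto
        moreover have "\<theta> \<noteq> 0" using \<theta> by auto
        ultimately show ?thesis by (simp only: mult_eq_0_iff of_real_eq_0_iff simp_thms)
      qed
      have "(\<Sum>I\<in>?K. complex_of_real (w I) * (\<Sum>J\<in>?K. complex_of_real (M I J) * z' J)) =
          (\<Sum>J\<in>?K. complex_of_real (\<Sum>I\<in>?K. w I * M I J) * z' J)"
        unfolding sum_distrib_left of_real_sum sum_distrib_right by (subst sum.swap) (simp add: mult_ac)
      also have "\<dots> = r * (\<Sum>J\<in>?K. complex_of_real (w J) * z' J)"
        unfolding sum_distrib_left by (intro sum.cong refl) (simp add: wM')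
      finally have "r * (\<Sum>J\<in>?K. complex_of_real (w J) * z' J) =
          (\<Sum>I\<in>?K. complex_of_real (w I) * (?e * (c * z I + \<mu> ?S1 * z' I)))"
        by (simp add: Mz')
      also have "\<dots> = ?e * c * (\<Sum>I\<in>?K. complex_of_real (w I) * z I) +
          ?e * \<mu> ?S0 * (\<Sum>I\<in>?K. complex_of_real (w I) * z' I)"
        unfolding True by (simp add: sum_distrib_left sum.distrib distrib_left mult_ac)
      finally have "?e * c = 0" using wz \<mu>r by simp
      then have c0: "c = 0" using e2 by auto
      \<comment> \<open>With \<open>c = 0\<close> all nonzero vectors of the plane are dominant
        eigenvectors. This one is made to vanish at \<open>?S0\<close>, but dominant eigenvectors
        have no zero entry.\<close>
      define s where "s = z' ?S0 / z ?S0"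
      have "(\<Sum>J\<in>?K. complex_of_real (M I J) * (z' J - s * z J)) = ?e * \<mu> ?S0 * (z' I - s * z I)"
        if I: "I \<in> ?K" for I
      proof -
        have "(\<Sum>J\<in>?K. complex_of_real (M I J) * (z' J - s * z J)) =
            ?e * (c * z I + \<mu> ?S1 * z' I) - s * (?e * \<mu> ?S0 * z I)"
          unfolding Mz[OF I, symmetric] Mz'[OF I, symmetric]
          unfolding sum_distrib_left sum_subtractf[symmetric] by (intro sum.cong refl) (simp add: algebra_simps)
        also have "\<dots> = ?e * \<mu> ?S0 * (z' I - s * z I)" unfolding c0 True by (simp add: algebra_simps)
        finally show ?thesis .
      qed
      from dom[OF this indep] obtain \<theta>' x' where "cmod \<theta>' = 1"
        "z' ?S0 - s * z ?S0 = \<theta>' * complex_of_real (x' ?S0)" "0 < x' ?S0"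
        using S0(1) r_le e2 by (auto simp: norm_mult)
      moreover have "z ?S0 \<noteq> 0" using zx[OF S0(1)] x[OF S0(1)] \<theta> by auto
      ultimately show False by (auto simp: s_def)
    qed
  qed
  then show ?thesis
    using that[OF r _ _ \<theta>] \<mu>r zx x unfolding \<mu>_def z_def C_def by blast
qed


section \<open>Sign variations\<close>

lemma sign_var_Nil [simp]: "sign_var [] = 0"
  and sign_var_single [simp]: "sign_var [x] = 0"
  by (auto simp: sign_var_def)

lemma sign_var_Cons_Cons [simp]:
  "sign_var (x # y # ys) = (if x * y < 0 then 1 else 0) + sign_var (y # ys)"
proof -
  let ?B = "{i. Suc i < length (y # ys) \<and> (y # ys) ! i * (y # ys) ! Suc i < 0}"
  let ?E = "if x * y < 0 then {0} else {} :: nat set"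
  have "i \<in> {i. Suc i < length (x # y # ys) \<and> (x # y # ys) ! i * (x # y # ys) ! Suc i < 0} \<longleftrightarrow>
      i \<in> ?E \<union> Suc ` ?B" for i
    by (cases i) auto
  then have eq: "{i. Suc i < length (x # y # ys) \<and> (x # y # ys) ! i * (x # y # ys) ! Suc i < 0} = ?E \<union> Suc ` ?B"
    by blast
  have "finite ?B" by (rule finite_subset[of _ "{..<length (y # ys)}"]) auto
  then have "card (?E \<union> Suc ` ?B) = card ?E + card (Suc ` ?B)" by (intro card_Un_disjoint) auto
  then show ?thesis unfolding sign_var_def eq by (simp add: card_image)
qed

lemma sign_var_le_length: "sign_var xs \<le> length xs"
proof -
  have "sign_var xs \<le> card {..<length xs}"
    unfolding sign_var_def by (intro card_mono) auto
  then show ?thesis by simp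
qed

text \<open>Anchoring the subsequence at position 0 and measuring signs against the head make the
  claim inductive: a new head either starts one more alternation or takes over the role of the old
  head.\<close>

lemma sign_var_alternating_subsequence:
  assumes "xs \<noteq> []" "\<forall>x\<in>set xs. x \<noteq> 0" "m \<le> sign_var xs"
  shows "\<exists>f. (\<forall>a b. a < b \<longrightarrow> b \<le> m \<longrightarrow> f a < f b) \<and> (\<forall>a\<le>m. f a < length xs) \<and> f 0 = 0 \<and>
    (\<forall>a\<le>m. 0 < xs ! 0 * (- 1) ^ a * xs ! f a)"
  using assms
proof (induction xs arbitrary: m rule: induct_list012)
  case 1
  then show ?case by simp
next
  case (2 x)
  then show ?case by (intro exI[of _ id]) (auto simp: zero_less_mult_iff)
next
  case (3 x y ys)
  \<comment> \<open>\<open>e\<close> counts the sign change at the front. If it is 1, the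
    subsequence of the tail is kept and moves up one place; if it is 0, its first position is
    replaced by the new head.\<close>
  define e :: nat where "e = (if x * y < 0 then 1 else 0)"
  have xy: "x \<noteq> 0" "y \<noteq> 0" using 3 by auto
  have "m - e \<le> sign_var (y # ys)" using "3.prems"(3) by (auto simp: e_def)
  from "3.IH"(2)[OF _ _ this] "3.prems"(2) obtain f where
    f: "\<And>a b. a < b \<Longrightarrow> b \<le> m - e \<Longrightarrow> f a < f b" "\<And>a. a \<le> m - e \<Longrightarrow> f a < length (y # ys)" "f 0 = 0"
    "\<And>a. a \<le> m - e \<Longrightarrow> 0 < y * (- 1) ^ a * (y # ys) ! f a"
    by auto
  define g where "g a = (if a = 0 then 0 else Suc (f (a - e)))" for a
  have "g a < g b" if "a < b" "b \<le> m" for a b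
  proof (cases "a = 0")
    case True
    then show ?thesis using that by (simp add: g_def)
  next
    case False
    then have "a - e < b - e" using that by (auto simp: e_def)
    then show ?thesis using f(1)[of "a - e" "b - e"] that False by (simp add: g_def)
  qed
  moreover have "g a < length (x # y # ys)" if "a \<le> m" for a
    using f(2)[of "a - e"] that by (simp add: g_def)
  moreover have "0 < x * (- 1) ^ a * (x # y # ys) ! g a" if a: "a \<le> m" for a
  proof (cases "a = 0")
    case True
    then show ?thesis using xy by (auto simp: g_def zero_less_mult_iff)
  next
    case False
    have pos: "0 < y * (- 1) ^ (a - e) * (y # ys) ! f (a - e)" using f(4)[of "a - e"] a by simp
    show ?thesis
    proof (cases "x * y < 0")
      case True
      then have "(- 1 :: real) ^ a = - ((- 1) ^ (a - e))" using False by (cases a) (auto simp: e_def)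
      then show ?thesis using True pos False
        by (auto simp: g_def mult_less_0_iff zero_less_mult_iff)
    next
      case nl: False
      then have "0 < x * y" using xy by (simp add: not_less zero_less_mult_iff mult_less_0_iff) linarith
      then show ?thesis using nl pos False
        by (auto simp: g_def e_def mult_less_0_iff zero_less_mult_iff)
    qed
  qed
  ultimately show ?case by (intro exI[of _ g]) (auto simp: g_def)
qed

text \<open>\<open>P\<close> records where the sign flips along the list, zeros being compatible
  with either sign. The last conjunct ties \<sigma> to the first nonzero entry, which the induction
  needs to decide whether a new head causes a flip.\<close>

lemma sign_var_change_points:
  fixes ys :: "real list"
  defines "F \<equiv> filter (\<lambda>a. a \<noteq> 0)"
  shows "\<exists>P \<sigma>. P \<subseteq> {1..<length ys} \<and> card P = sign_var (F ys) \<and> \<sigma> \<in> {-1, 1} \<and>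
    (\<forall>j<length ys. 0 \<le> \<sigma> * (- 1) ^ card {i \<in> P. i \<le> j} * ys ! j) \<and>
    (F ys \<noteq> [] \<longrightarrow> 0 < \<sigma> * hd (F ys))"
proof (induction ys)
  case Nil
  then show ?case by (auto simp: F_def)
next
  case (Cons x ys)
  then obtain P \<sigma> where P: "P \<subseteq> {1..<length ys}" "card P = sign_var (F ys)" and \<sigma>: "\<sigma> \<in> {-1, 1}"
    and nn: "\<And>j. j < length ys \<Longrightarrow> 0 \<le> \<sigma> * (- 1) ^ card {i \<in> P. i \<le> j} * ys ! j"
    and hd: "F ys \<noteq> [] \<Longrightarrow> 0 < \<sigma> * hd (F ys)"
    by blast
  have fin: "finite P" using P(1) by (rule finite_subset) simp
  have 0: "{i \<in> Suc ` P. i \<le> 0} = {}" by auto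
  have "{i \<in> Suc ` P. i \<le> Suc j} = Suc ` {i \<in> P. i \<le> j}" for j by auto
  then have S: "card {i \<in> Suc ` P. i \<le> Suc j} = card {i \<in> P. i \<le> j}" for j by (simp add: card_image)
  have P': "Suc ` P \<subseteq> {1..<length (x # ys)}" "card (Suc ` P) = sign_var (F ys)"
    using P by (auto simp: card_image)
  show ?case
  proof (cases "x * hd (F ys) < 0 \<and> F ys \<noteq> []")
    case False
    show ?thesis
    \<comment> \<open>If the tail has only zeros, the induction hypothesis does not determine
      \<sigma>, so it is chosen afresh from the head.\<close>
    proof (cases "x \<noteq> 0 \<and> F ys = []")
      case True
      then have "ys ! j = 0" if "j < length ys" for j
        using that nth_mem[OF that] by (auto simp: F_def filter_empty_conv)
      then have "0 \<le> sgn x * (x # ys) ! j" if "j < length (x # ys)" for j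
        using that by (cases j) (auto simp: sgn_if)
      then show ?thesis using True
        by (intro exI[of _ "{}"] exI[of _ "sgn x"]) (auto simp: F_def sgn_if)
    next
      case ne: False
      have x: "x = 0 \<or> 0 < \<sigma> * x"
        using False ne hd by (auto simp: zero_less_mult_iff mult_less_0_iff not_less)
      have sv: "sign_var (F (x # ys)) = sign_var (F ys)"
        using False ne by (cases "F ys") (auto simp: F_def)
      have "0 \<le> \<sigma> * (- 1) ^ card {i \<in> Suc ` P. i \<le> j} * (x # ys) ! j" if "j < length (x # ys)" for j
      proof (cases j)
        case j: 0
        have "card {i \<in> Suc ` P. i \<le> j} = 0" unfolding j 0 by simp
        then show ?thesis using x j by (simp only:) auto
      next
        case (Suc j')
        then show ?thesis using nn[of j'] that by (simp only: S nth_Cons_Suc) simp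
      qed
      then show ?thesis using P' \<sigma> x hd sv
        by (intro exI[of _ "Suc ` P"] exI[of _ \<sigma>]) (auto simp: F_def)
    qed
  next
    case True
    then have x: "x \<noteq> 0" "0 < - \<sigma> * x" using hd by (auto simp: zero_less_mult_iff mult_less_0_iff)
    \<comment> \<open>The flip is placed directly behind the new head. Zeros before the next nonzero
      entry satisfy the weak inequality all the same.\<close>
    let ?P = "insert 1 (Suc ` P)"
    have ne: "ys \<noteq> []" using True by (auto simp: F_def)
    have "1 \<notin> Suc ` P" using P(1) by auto
    then have cP: "card ?P = Suc (sign_var (F ys))" using P' fin by simp
    have sv: "sign_var (F (x # ys)) = Suc (sign_var (F ys))"
      using True x by (cases "F ys") (auto simp: F_def)
    have SS: "card {i \<in> ?P. i \<le> Suc j} = Suc (card {i \<in> P. i \<le> j})" for j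
    proof -
      have "{i \<in> ?P. i \<le> Suc j} = insert 1 {i \<in> Suc ` P. i \<le> Suc j}" by auto
      then show ?thesis using \<open>1 \<notin> Suc ` P\<close> fin S[of j] by simp
    qed
    have "0 \<le> - \<sigma> * (- 1) ^ card {i \<in> ?P. i \<le> j} * (x # ys) ! j" if "j < length (x # ys)" for j
    proof (cases j)
      case 0
      then have "{i \<in> ?P. i \<le> j} = {}" by auto
      then have "card {i \<in> ?P. i \<le> j} = 0" by (simp only: card.empty)
      then show ?thesis using x 0 by (simp only:) simp
    next
      case (Suc j')
      then show ?thesis using nn[of j'] that by (simp only: SS nth_Cons_Suc) simp
    qed
    moreover have "?P \<subseteq> {1..<length (x # ys)}" using P'(1) ne by auto
    moreover have "- \<sigma> \<in> {-1, 1}" using \<sigma> by auto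
    moreover have "hd (F (x # ys)) = x" using x by (simp add: F_def)
    ultimately show ?thesis using cP sv x
      by (intro exI[of _ ?P] exI[of _ "- \<sigma>"]) simp
  qed
qed

text \<open>Surplus points are put at the left end, where they change all later parities alike.\<close>

lemma s_minus_sign_pattern:
  fixes y :: "real vec"
  assumes y: "y \<in> carrier_vec n" and m: "s_minus y \<le> m" "m \<le> n"
  obtains I \<sigma> where "I \<in> index_sets n m" "\<sigma> \<in> {-1, 1}"
    "\<And>j. j < n \<Longrightarrow> j \<notin> I \<Longrightarrow> 0 \<le> \<sigma> * (- 1) ^ card {i \<in> I. i < j} * y $ j"
proof -
  obtain P \<sigma> where P: "P \<subseteq> {1..<n}" "card P = s_minus y" and \<sigma>: "\<sigma> \<in> {-1, 1}"
    and nn: "\<And>j. j < n \<Longrightarrow> 0 \<le> \<sigma> * (- 1) ^ card {i \<in> P. i \<le> j} * y $ j"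
    using sign_var_change_points[of "list_of_vec y"] y unfolding s_minus_def
    by (auto simp: list_of_vec_index)
  have fin: "finite P" using P(1) by (rule finite_subset) simp
  \<comment> \<open>Each increase of t adds at most one point, so the least sufficient t gives
    exactly m points.\<close>
  define t where "t = (LEAST t. m \<le> card (P \<union> {..<t}))"
  have "P \<union> {..<n} = {..<n}" using P(1) by auto
  then have ex: "m \<le> card (P \<union> {..<n})" using m by simp
  have t: "m \<le> card (P \<union> {..<t})" unfolding t_def by (rule LeastI[of _ n]) (rule ex)
  have tn: "t \<le> n" unfolding t_def by (rule Least_le) (rule ex)
  have "card (P \<union> {..<t}) \<le> m"
  proof (cases t)
    case 0
    then show ?thesis using P m by simp
  next
    case (Suc s)
    then have "card (P \<union> {..<s}) < m"
      using not_less_Least[of s "\<lambda>t. m \<le> card (P \<union> {..<t})"] unfolding t_def by simp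
    moreover have "P \<union> {..<t} = insert s (P \<union> {..<s})" using Suc by auto
    then have "card (P \<union> {..<t}) \<le> Suc (card (P \<union> {..<s}))" by (simp add: card_insert_le_m1 card_insert_if fin)
    ultimately show ?thesis by simp
  qed
  then have I: "P \<union> {..<t} \<in> index_sets n m" using t tn P(1) by (auto simp: index_sets_def)
  have "0 \<le> \<sigma> * (- 1) ^ card ({..<t} - P) * (- 1) ^ card {i \<in> P \<union> {..<t}. i < j} * y $ j"
    if j: "j < n" "j \<notin> P \<union> {..<t}" for j
  proof -
    have "{i \<in> P \<union> {..<t}. i < j} = {i \<in> P. i \<le> j} \<union> ({..<t} - P)"
      using j by (auto simp: less_le intro: le_neq_trans)
    then have "card {i \<in> P \<union> {..<t}. i < j} = card {i \<in> P. i \<le> j} + card ({..<t} - P)"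
      using fin by (simp only:) (subst card_Un_disjoint, auto)
    then show ?thesis using nn[OF j(1)] by (simp add: power_add mult_ac power2_eq_square[symmetric] flip: power_mult_distrib)
  qed
  moreover have "\<sigma> * (- 1) ^ card ({..<t} - P) \<in> {-1, 1}" using \<sigma> by (cases "even (card ({..<t} - P))") auto
  ultimately show ?thesis using that I by blast
qed

text \<open>A filling that attains the maximum alternates strictly at m + 1 positions; there
  \<open>y\<close> agrees with it or is 0, hence alternates weakly. \<sigma> is the leading entry of
  the filling, so it need not be a unit. The condition \<open>0 < m\<close> ensures that there is a
  leading entry.\<close>

lemma s_plus_sign_pattern:
  fixes y :: "real vec"
  assumes y: "y \<in> carrier_vec n" and m: "0 < m" "m \<le> s_plus y"
  obtains f \<sigma> where "\<And>a b. a < b \<Longrightarrow> b \<le> m \<Longrightarrow> f a < f b" "\<And>a. a \<le> m \<Longrightarrow> f a < n" "\<sigma> \<noteq> 0"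
    "\<And>a. a \<le> m \<Longrightarrow> 0 \<le> \<sigma> * (- 1) ^ a * y $ f a"
proof -
  let ?Z = "{sign_var (list_of_vec z) | z. dim_vec z = dim_vec y \<and>
     (\<forall>i < dim_vec y. if y $ i = 0 then z $ i \<in> {1, -1} else z $ i = y $ i)}"
  have "?Z \<subseteq> {..n}"
  proof safe
    fix z :: "real vec" assume "dim_vec z = dim_vec y"
    then show "sign_var (list_of_vec z) \<le> n" using sign_var_le_length[of "list_of_vec z"] y by simp
  qed
  then have "finite ?Z" by (rule finite_subset) simp
  moreover have "sign_var (list_of_vec (vec n (\<lambda>i. if y $ i = 0 then 1 else y $ i))) \<in> ?Z"
    using y by (intro CollectI exI[of _ "vec n (\<lambda>i. if y $ i = 0 then 1 else y $ i)"]) auto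
  then have "?Z \<noteq> {}" by (metis empty_iff)
  ultimately have "Max ?Z \<in> ?Z" by (rule Max_in)
  then obtain z where z: "dim_vec z = n" "s_plus y = sign_var (list_of_vec z)"
    and zy: "\<And>i. i < n \<Longrightarrow> if y $ i = 0 then z $ i \<in> {1, -1} else z $ i = y $ i"
    using y unfolding s_plus_def by auto
  have nz: "z $ i \<noteq> 0" if "i < n" for i using zy[OF that] by (auto split: if_splits)
  have "list_of_vec z \<noteq> []" using z(2) m by auto
  moreover have "\<forall>x\<in>set (list_of_vec z). x \<noteq> 0"
    using nz z(1) by (auto simp: in_set_conv_nth list_of_vec_index)
  ultimately obtain f where f: "\<And>a b. a < b \<Longrightarrow> b \<le> m \<Longrightarrow> f a < f b" "\<And>a. a \<le> m \<Longrightarrow> f a < n" "f 0 = 0"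
    "\<And>a. a \<le> m \<Longrightarrow> 0 < list_of_vec z ! 0 * (- 1) ^ a * list_of_vec z ! f a"
    using sign_var_alternating_subsequence[of "list_of_vec z" m] m(2) z(1) unfolding z(2) length_list_of_vec by blast
  have fn: "f 0 < n" using f(2)[of 0] by simp
  have "0 \<le> z $ 0 * (- 1) ^ a * y $ f a" if a: "a \<le> m" for a
  proof (cases "y $ f a = 0")
    case False
    then have "z $ f a = y $ f a" using zy[OF f(2)[OF a]] by simp
    then show ?thesis using f(4)[OF a] f(2)[OF a] z(1) fn f(3) by (simp add: list_of_vec_index)
  qed simp
  then show ?thesis using that[of f "z $ 0"] f nz fn by simp
qed


section \<open>Sign variations in spans with one-signed minors\<close>

lemma submatrix_frame_entry:
  assumes "P \<in> carrier_mat n n" "I \<in> index_sets n k" "k \<le> n" "a < k" "l < k"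
  shows "submatrix P I {0..<k} $$ (a, l) = P $$ (pick I a, l)"
  using assms(4,5) by (simp add: submatrix_eq[OF assms(1,2) index_sets_initial(1)[OF assms(3)]]
    index_sets_initial(2)[OF assms(3)])

text \<open>The rows in \<open>I\<close> form an invertible square block, so k zeros in suitable
  positions annihilate a whole element of the span.\<close>

lemma frame_kernel_trivial:
  fixes P :: "complex mat"
  assumes P: "P \<in> carrier_mat n n" and I: "I \<in> index_sets n k" and k: "k \<le> n"
    and det: "det (submatrix P I {0..<k}) \<noteq> 0"
    and eq: "\<And>i. i \<in> I \<Longrightarrow> (\<Sum>l = 0..<k. P $$ (i, l) * d l) = 0" and l: "l < k"
  shows "d l = 0"
proof -
  let ?S = "submatrix P I {0..<k}"
  have S: "?S \<in> carrier_mat k k" by (rule submatrix_carrier[OF P I index_sets_initial(1)[OF k]])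
  have "?S *\<^sub>v vec k d = 0\<^sub>v k"
  proof (rule eq_vecI)
    fix a assume "a < dim_vec (0\<^sub>v k :: complex vec)"
    then have a: "a < k" by simp
    have "(?S *\<^sub>v vec k d) $ a = (\<Sum>l = 0..<k. ?S $$ (a, l) * d l)"
      using S a by (auto simp: scalar_prod_def intro!: sum.cong)
    also have "\<dots> = (\<Sum>l = 0..<k. P $$ (pick I a, l) * d l)"
      using submatrix_frame_entry[OF P I k a] by (intro sum.cong) auto
    finally show "(?S *\<^sub>v vec k d) $ a = 0\<^sub>v k $ a" using eq[OF pick_index_sets(1)[OF I a]] a by simp
  qed (use S in simp)
  then have "vec k d = 0\<^sub>v k"
    using det_0_iff_vec_prod_zero_field[OF S] det by (metis vec_carrier)
  then show ?thesis using l by (metis index_vec index_zero_vec(1))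
qed

text \<open>
  Expansion along the first column of the singular matrix whose rows are \<open>(y $ i, P $$ (i, 0), \<dots>)\<close>,
  \<open>i\<close> running through positions at which \<open>y\<close> weakly alternates.
\<close>

lemma s_plus_less_frame:
  fixes P :: "complex mat" and y :: "real vec"
  assumes P: "P \<in> carrier_mat n n" and k: "0 < k" "k \<le> n" and y: "y \<in> carrier_vec n" "y \<noteq> 0\<^sub>v n"
    and minor: "\<And>I. I \<in> index_sets n k \<Longrightarrow> det (submatrix P I {0..<k}) = \<theta> * complex_of_real (x I)"
      "\<And>I. I \<in> index_sets n k \<Longrightarrow> 0 < x I" "\<theta> \<noteq> 0"
    and span: "\<And>j. j < n \<Longrightarrow> complex_of_real (y $ j) = (\<Sum>l = 0..<k. P $$ (j, l) * d l)"
  shows "s_plus y < k"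
proof (rule ccontr)
  assume "\<not> ?thesis"
  then obtain f \<sigma> where f: "\<And>a b. a < b \<Longrightarrow> b \<le> k \<Longrightarrow> f a < f b" "\<And>a. a \<le> k \<Longrightarrow> f a < n"
    and \<sigma>: "\<sigma> \<noteq> 0" "\<And>a. a \<le> k \<Longrightarrow> 0 \<le> \<sigma> * (- 1) ^ a * y $ f a"
    using s_plus_sign_pattern[OF y(1) k(1)] by (metis not_less)
  define G where "G = mat (Suc k) (Suc k)
    (\<lambda>(a, b). if b = 0 then complex_of_real (y $ f a) else P $$ (f a, b - 1))"
  have G: "G \<in> carrier_mat (Suc k) (Suc k)" by (simp add: G_def)
  \<comment> \<open>The kernel vector (1, -d) expresses the first column of \<open>G\<close> through
    the others.\<close>
  define u where "u = vec (Suc k) (\<lambda>b. if b = 0 then 1 else - d (b - 1))"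
  have "G *\<^sub>v u = 0\<^sub>v (Suc k)"
  proof (rule eq_vecI)
    fix a assume "a < dim_vec (0\<^sub>v (Suc k) :: complex vec)"
    then have a: "a < Suc k" by simp
    have "(G *\<^sub>v u) $ a = (\<Sum>b = 0..<Suc k. G $$ (a, b) * u $ b)"
      using G a by (auto simp: scalar_prod_def u_def intro!: sum.cong)
    also have "\<dots> = complex_of_real (y $ f a) - (\<Sum>l = 0..<k. P $$ (f a, l) * d l)"
      using a by (subst sum.atLeast0_lessThan_Suc_shift) (simp add: G_def u_def sum_negf)
    finally show "(G *\<^sub>v u) $ a = 0\<^sub>v (Suc k) $ a" using span[OF f(2)[of a]] a by simp
  qed (simp add: G_def)
  moreover have "u \<in> carrier_vec (Suc k)" "u $ 0 = 1" by (auto simp: u_def)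
  then have "u \<noteq> 0\<^sub>v (Suc k)" by auto
  ultimately have "det G = 0"
    using det_0_iff_vec_prod_zero_field[OF G] \<open>u \<in> carrier_vec (Suc k)\<close> by blast
  \<comment> \<open>\<open>g a\<close> enumerates the selected positions without number
    \<open>a\<close>, the rows that remain after deleting row \<open>a\<close> of
    \<open>G\<close>.\<close>
  define g where "g a b = f (if b < a then b else Suc b)" for a b
  have g: "g a b < g a c" if "b < c" "c < k" for a b c
    using that by (auto simp: g_def intro!: f(1))
  have gI: "g a ` {0..<k} \<in> index_sets n k" for a
  proof (rule image_in_index_sets)
    show "g a b < n" if "b < k" for b using that f(2) by (simp add: g_def)
  qed (rule g)
  have "cofactor G a 0 = (- 1) ^ a * (\<theta> * complex_of_real (x (g a ` {0..<k})))" if a: "a \<le> k" for a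
  proof -
    have "mat_delete G a 0 = submatrix P (g a ` {0..<k}) {0..<k}"
    proof (rule eq_matI)
      fix i j assume "i < dim_row (submatrix P (g a ` {0..<k}) {0..<k})" "j < dim_col (submatrix P (g a ` {0..<k}) {0..<k})"
      then have ij: "i < k" "j < k"
        using submatrix_carrier[OF P gI index_sets_initial(1)[OF k(2)], of a] by auto
      have "pick (g a ` {0..<k}) i = g a i" by (rule pick_strict_mono_image[OF g ij(1)])
      then show "mat_delete G a 0 $$ (i, j) = submatrix P (g a ` {0..<k}) {0..<k} $$ (i, j)"
        unfolding submatrix_frame_entry[OF P gI k(2) ij] using ij a
        by (auto simp: mat_delete_def G_def g_def)
    qed (use submatrix_carrier[OF P gI index_sets_initial(1)[OF k(2)], of a] in \<open>auto simp: mat_delete_def G_def\<close>)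
    then show ?thesis unfolding cofactor_def by (simp add: minor(1)[OF gI])
  qed
  then have "det G = (\<Sum>a<Suc k. complex_of_real (y $ f a) * ((- 1) ^ a * (\<theta> * complex_of_real (x (g a ` {0..<k})))))"
    by (subst laplace_expansion_column[OF G, of 0]) (auto simp: G_def intro!: sum.cong)
  also have "\<dots> = \<theta> * complex_of_real (\<Sum>a<Suc k. (- 1) ^ a * y $ f a * x (g a ` {0..<k}))"
    unfolding of_real_sum sum_distrib_left by (intro sum.cong refl) (simp add: mult_ac)
  finally have "(\<Sum>a<Suc k. (- 1) ^ a * y $ f a * x (g a ` {0..<k})) = 0"
    using minor(3) unfolding \<open>det G = 0\<close> by (simp only: mult_eq_0_iff of_real_eq_0_iff eq_commute[of 0] simp_thms)
  then have "\<sigma> * (\<Sum>a<Suc k. (- 1) ^ a * y $ f a * x (g a ` {0..<k})) = 0" by simp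
  then have s0: "(\<Sum>a<Suc k. \<sigma> * (- 1) ^ a * y $ f a * x (g a ` {0..<k})) = 0"
    by (simp only: sum_distrib_left mult.assoc)
  \<comment> \<open>The terms have one weak sign and the weights \<open>x\<close> are strictly
    positive, so each entry vanishes. Zeros at k of the k + 1 positions already annihilate the
    coefficients \<open>d\<close>.\<close>
  have y0: "y $ f a = 0" if a: "a \<le> k" for a
  proof -
    have "\<sigma> * (- 1) ^ a * y $ f a * x (g a ` {0..<k}) = 0"
      by (rule sum_nonneg_0[OF _ _ s0]) (use a \<sigma> less_imp_le[OF minor(2)[OF gI]] in \<open>auto intro!: mult_nonneg_nonneg\<close>)
    then show ?thesis using \<sigma> minor(2)[OF gI, of a] by auto
  qed
  have fI: "f ` {0..<k} \<in> index_sets n k" by (rule image_in_index_sets) (auto intro: f)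
  have "d l = 0" if "l < k" for l
  proof (rule frame_kernel_trivial[OF P fI k(2) _ _ that])
    show "det (submatrix P (f ` {0..<k}) {0..<k}) \<noteq> 0"
      using minor(1,2)[OF fI] minor(3) by auto
    show "(\<Sum>l = 0..<k. P $$ (i, l) * d l) = 0" if "i \<in> f ` {0..<k}" for i
      using that y0 by (auto simp: span[symmetric] f(2))
  qed
  then have "y $ j = 0" if "j < n" for j using span[OF that] by simp
  then show False using y by auto
qed

text \<open>
  Bordering the rows in \<open>I\<close> of \<open>Q\<close> by row \<open>j\<close> gives an element \<open>j \<mapsto> w j\<close> of the column span of
  \<open>Q\<close> that vanishes on \<open>I\<close> and changes sign exactly there. Choosing \<open>I\<close> at the sign changes
  of \<open>y\<close> makes all terms of the vanishing sum of the \<open>y $ j * w j\<close> have one sign.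
\<close>

lemma le_s_minus_frame:
  fixes Q :: "complex mat" and y :: "real vec"
  assumes Q: "Q \<in> carrier_mat n n" and k: "0 < k" "k \<le> n" and y: "y \<in> carrier_vec n" "y \<noteq> 0\<^sub>v n"
    and minor: "\<And>I. I \<in> index_sets n k \<Longrightarrow> det (submatrix Q I {0..<k}) = \<theta> * complex_of_real (x I)"
      "\<And>I. I \<in> index_sets n k \<Longrightarrow> 0 < x I" "\<theta> \<noteq> 0"
    and orth: "\<And>l. l < k \<Longrightarrow> (\<Sum>j<n. complex_of_real (y $ j) * Q $$ (j, l)) = 0"
  shows "k \<le> s_minus y"
proof (rule ccontr)
  assume "\<not> ?thesis"
  then have "s_minus y \<le> k - 1" "k - 1 \<le> n" using k by auto
  then obtain I \<sigma> where I: "I \<in> index_sets n (k - 1)" and \<sigma>: "\<sigma> \<in> {-1, 1}"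
    and nn: "\<And>j. j < n \<Longrightarrow> j \<notin> I \<Longrightarrow> 0 \<le> \<sigma> * (- 1) ^ card {i \<in> I. i < j} * y $ j"
    using s_minus_sign_pattern[OF y(1), of "k - 1"] by metis
  obtain m where m: "k = Suc m" using k by (cases k) auto
  have Im: "I \<in> index_sets n m" using I m by simp
  have finI: "finite I" by (rule index_setsD(3)[OF I])
  have IJ: "insert j I \<in> index_sets n k" if "j < n" "j \<notin> I" for j
    using I that finI by (auto simp: index_sets_def m)
  define R where "R j = mat k k (\<lambda>(a, l). if a = 0 then Q $$ (j, l) else Q $$ (pick I (a - 1), l))" for j
  have R: "R j \<in> carrier_mat k k" for j by (simp add: R_def)
  \<comment> \<open>These minors use only the rows in \<open>I\<close>. Being independent of
    \<open>j\<close>, they make \<open>det (R j)\<close> a fixed combination of the first k columns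
    of \<open>Q\<close>, to all of which \<open>y\<close> is orthogonal.\<close>
  define D where "D l = det (mat m m (\<lambda>(a, b). Q $$ (pick I a, if b < l then b else Suc b)))" for l
  have detR: "det (R j) = (\<Sum>l<k. Q $$ (j, l) * ((- 1) ^ l * D l))" for j
  proof (subst laplace_expansion_row[OF R k(1)], intro sum.cong refl)
    fix l assume "l \<in> {..<k}"
    moreover have "mat_delete (R j) 0 l = mat m m (\<lambda>(a, b). Q $$ (pick I a, if b < l then b else Suc b))"
      by (rule eq_matI) (auto simp: mat_delete_def R_def m)
    ultimately show "R j $$ (0, l) * cofactor (R j) 0 l = Q $$ (j, l) * ((- 1) ^ l * D l)"
      by (simp add: cofactor_def D_def R_def k(1))
  qed
  have wI: "det (R j) = 0" if j: "j \<in> I" for j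
  proof -
    have c: "Suc (card {i \<in> I. i < j}) < k" using card_below_less[OF Im j] by (simp add: m)
    show ?thesis
      by (rule det_identical_rows[OF R, of 0 "Suc (card {i \<in> I. i < j})"])
         (use c k j in \<open>auto simp: R_def pick_card_in_set intro!: eq_vecI\<close>)
  qed
  \<comment> \<open>In the sorted set \<open>insert j I\<close> row \<open>j\<close> stands at place
    \<open>?c\<close> instead of on top. Expanding both determinants along that row gives the same
    minors \<open>D l\<close>, so only the factor \<open>(- 1) ^ ?c\<close> separates them.\<close>
  have w: "det (R j) = (- 1) ^ card {i \<in> I. i < j} * (\<theta> * complex_of_real (x (insert j I)))"
    if j: "j < n" "j \<notin> I" for j
  proof -
    let ?J = "insert j I" and ?c = "card {i \<in> I. i < j}"
    note J = IJ[OF j]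
    let ?S = "submatrix Q ?J {0..<k}"
    have S: "?S \<in> carrier_mat k k" by (rule submatrix_carrier[OF Q J index_sets_initial(1)[OF k(2)]])
    have "{i \<in> ?J. i < j} = {i \<in> I. i < j}" by auto
    then have pj: "pick ?J ?c = j" using pick_card_in_set[of j ?J] by simp
    have ck: "?c < k" using card_below_less[OF J, of j] \<open>{i \<in> ?J. i < j} = {i \<in> I. i < j}\<close> by simp
    have skip: "pick ?J (if a < ?c then a else Suc a) = pick I a" if a: "a < m" for a
    proof -
      let ?i = "pick I a"
      have i: "?i \<in> I" "card {b \<in> I. b < ?i} = a" using pick_index_sets(1)[OF Im a] card_below_pick[OF Im a] by auto
      have "?i \<noteq> j" using i(1) j(2) by auto
      have lt: "a < ?c" if "?i < j"
      proof -
        have "{b \<in> I. b < ?i} \<subset> {b \<in> I. b < j}" using that i(1) by auto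
        then have "card {b \<in> I. b < ?i} < ?c" using finI by (intro psubset_card_mono) auto
        then show ?thesis using i(2) by simp
      qed
      have ge: "?c \<le> a" if "j < ?i"
      proof -
        have "?c \<le> card {b \<in> I. b < ?i}" using that finI by (intro card_mono) auto
        then show ?thesis using i(2) by simp
      qed
      have "card {b \<in> ?J. b < ?i} = (if a < ?c then a else Suc a)"
      proof (cases "?i < j")
        case True
        then have "{b \<in> ?J. b < ?i} = {b \<in> I. b < ?i}" by auto
        then show ?thesis using lt[OF True] i(2) by simp
      next
        case False
        then have "j < ?i" using \<open>?i \<noteq> j\<close> by simp
        then have "{b \<in> ?J. b < ?i} = insert j {b \<in> I. b < ?i}" by auto
        then show ?thesis using ge[OF \<open>j < ?i\<close>] i(2) j(2) finI by simp
      qed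
      then show ?thesis using pick_card_in_set[of ?i ?J] i(1) by simp
    qed
    have "det ?S = (\<Sum>l<k. Q $$ (j, l) * ((- 1) ^ (?c + l) * D l))"
    proof (subst laplace_expansion_row[OF S ck], intro sum.cong refl)
      fix l assume l: "l \<in> {..<k}"
      have "mat_delete ?S ?c l = mat m m (\<lambda>(a, b). Q $$ (pick I a, if b < l then b else Suc b))"
      proof (rule eq_matI)
        fix a b assume "a < dim_row (mat m m (\<lambda>(a, b). Q $$ (pick I a, if b < l then b else Suc b)))"
          "b < dim_col (mat m m (\<lambda>(a, b). Q $$ (pick I a, if b < l then b else Suc b)))"
        then have ab: "a < m" "b < m" by auto
        have "mat_delete ?S ?c l $$ (a, b) = ?S $$ (if a < ?c then a else Suc a, if b < l then b else Suc b)"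
          using ab carrier_matD[OF S] by (simp add: mat_delete_def m)
        also have "\<dots> = Q $$ (pick ?J (if a < ?c then a else Suc a), if b < l then b else Suc b)"
          by (rule submatrix_frame_entry[OF Q J k(2)]) (use ab in \<open>auto simp: m\<close>)
        finally show "mat_delete ?S ?c l $$ (a, b) =
            mat m m (\<lambda>(a, b). Q $$ (pick I a, if b < l then b else Suc b)) $$ (a, b)"
          unfolding skip[OF ab(1)] using ab by simp
      qed (use carrier_matD[OF S] in \<open>auto simp: mat_delete_def m\<close>)
      moreover have "?S $$ (?c, l) = Q $$ (j, l)"
        using submatrix_frame_entry[OF Q J k(2) ck] l pj by simp
      ultimately show "?S $$ (?c, l) * cofactor ?S ?c l = Q $$ (j, l) * ((- 1) ^ (?c + l) * D l)"
        by (simp add: cofactor_def D_def)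
    qed
    also have "\<dots> = (- 1) ^ ?c * det (R j)"
      unfolding detR sum_distrib_left by (intro sum.cong refl) (simp add: power_add mult_ac)
    finally have "(- 1) ^ ?c * det ?S = ((- 1) ^ ?c * (- 1) ^ ?c) * det (R j)" by simp
    also have "(- 1 :: complex) ^ ?c * (- 1) ^ ?c = 1" by (simp flip: power_mult_distrib)
    finally show ?thesis using minor(1)[OF J] by simp
  qed
  have "(\<Sum>j<n. complex_of_real (y $ j) * det (R j)) =
      (\<Sum>l<k. ((- 1) ^ l * D l) * (\<Sum>j<n. complex_of_real (y $ j) * Q $$ (j, l)))"
    unfolding detR sum_distrib_left by (subst sum.swap) (simp add: mult_ac)
  also have "\<dots> = 0" using orth by simp
  finally have "0 = (\<Sum>j<n. complex_of_real (y $ j) * det (R j))" by simp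
  also have "\<dots> = (\<Sum>j\<in>{..<n} - I. complex_of_real (y $ j) * det (R j))"
    by (rule sum.mono_neutral_right) (auto simp: wI)
  also have "\<dots> = \<theta> * complex_of_real (\<Sum>j\<in>{..<n} - I. (- 1) ^ card {i \<in> I. i < j} * y $ j * x (insert j I))"
    unfolding of_real_sum sum_distrib_left by (intro sum.cong refl) (simp add: w mult_ac)
  finally have "(\<Sum>j\<in>{..<n} - I. (- 1) ^ card {i \<in> I. i < j} * y $ j * x (insert j I)) = 0"
    using minor(3) by (simp only: mult_eq_0_iff of_real_eq_0_iff eq_commute[of 0] simp_thms)
  then have "\<sigma> * (\<Sum>j\<in>{..<n} - I. (- 1) ^ card {i \<in> I. i < j} * y $ j * x (insert j I)) = 0" by simp
  then have s0: "(\<Sum>j\<in>{..<n} - I. \<sigma> * (- 1) ^ card {i \<in> I. i < j} * y $ j * x (insert j I)) = 0"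
    by (simp only: sum_distrib_left mult.assoc)
  have y0: "y $ j = 0" if j: "j < n" "j \<notin> I" for j
  proof -
    have "\<sigma> * (- 1) ^ card {i \<in> I. i < j} * y $ j * x (insert j I) = 0"
      by (rule sum_nonneg_0[OF _ _ s0]) (use j nn less_imp_le[OF minor(2)[OF IJ]] in \<open>auto intro!: mult_nonneg_nonneg\<close>)
    then show ?thesis using \<sigma> minor(2)[OF IJ[OF j]] by auto
  qed
  \<comment> \<open>Now \<open>y\<close> is supported on the k - 1 elements of \<open>I\<close>. One
    further position completes a k-set, on which the orthogonality relations become a square system
    with nonzero determinant.\<close>
  have "I \<noteq> {..<n}" using index_setsD(2)[OF Im] k m by auto
  then obtain j0 where j0: "j0 < n" "j0 \<notin> I" using index_setsD(1)[OF I] by auto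
  let ?J = "insert j0 I"
  note J = IJ[OF j0]
  let ?S = "submatrix Q ?J {0..<k}"
  have S: "?S \<in> carrier_mat k k" by (rule submatrix_carrier[OF Q J index_sets_initial(1)[OF k(2)]])
  let ?u = "vec k (\<lambda>a. complex_of_real (y $ pick ?J a))"
  have "transpose_mat ?S *\<^sub>v ?u = 0\<^sub>v k"
  proof (rule eq_vecI)
    fix l assume "l < dim_vec (0\<^sub>v k :: complex vec)"
    then have l: "l < k" by simp
    have "(transpose_mat ?S *\<^sub>v ?u) $ l = (\<Sum>a = 0..<k. ?S $$ (a, l) * complex_of_real (y $ pick ?J a))"
      using S l by (auto simp: scalar_prod_def intro!: sum.cong)
    also have "\<dots> = (\<Sum>a = 0..<k. complex_of_real (y $ pick ?J a) * Q $$ (pick ?J a, l))"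
      by (intro sum.cong refl) (simp add: submatrix_frame_entry[OF Q J k(2) _ l])
    also have "\<dots> = (\<Sum>j\<in>?J. complex_of_real (y $ j) * Q $$ (j, l))"
      by (rule sum.reindex_bij_betw[OF bij_betw_pick[OF J]])
    also have "\<dots> = (\<Sum>j<n. complex_of_real (y $ j) * Q $$ (j, l))"
      using index_setsD(1)[OF J] y0 by (intro sum.mono_neutral_left) auto
    finally show "(transpose_mat ?S *\<^sub>v ?u) $ l = 0\<^sub>v k $ l" using orth[OF l] l by simp
  qed (use S in simp)
  moreover have "det (transpose_mat ?S) \<noteq> 0"
    using det_transpose[OF S] minor(1,2)[OF J] minor(3) by auto
  ultimately have "?u = 0\<^sub>v k"
    using det_0_iff_vec_prod_zero_field[of "transpose_mat ?S" k] S by (metis transpose_carrier_mat vec_carrier)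
  then have u0: "y $ pick ?J a = 0" if "a < k" for a
    using that by (metis index_vec index_zero_vec(1) of_real_eq_0_iff)
  have "y $ j = 0" if "j < n" for j
  proof (cases "j \<in> ?J")
    case True
    then have "j \<in> pick ?J ` {0..<k}" by (simp only: bij_betw_imp_surj_on[OF bij_betw_pick[OF J]])
    then obtain a where "a < k" "j = pick ?J a" by auto
    then show ?thesis using u0 by simp
  next
    case False
    then show ?thesis using y0 that by simp
  qed
  then show False using y by auto
qed


section \<open>Eigenvectors\<close>

text \<open>This turns independence of an image set, together with injectivity, into a statement
  about finite sums of entries, the only form in which independence is used below.\<close>

lemma lin_indpt_family_iff:
  fixes f :: "'i \<Rightarrow> 'a :: field vec"
  assumes I: "finite I" and f: "\<And>i. i \<in> I \<Longrightarrow> f i \<in> carrier_vec n"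
  shows "lin_indpt_family n f I \<longleftrightarrow>
    (\<forall>c. (\<forall>j<n. (\<Sum>i\<in>I. c i * f i $ j) = 0) \<longrightarrow> (\<forall>i\<in>I. c i = 0))" (is "_ \<longleftrightarrow> ?R")
proof
  interpret V: vec_space "TYPE('a)" n .
  have fI: "f ` I \<subseteq> carrier_vec n" "finite (f ` I)" using f I by auto
  {
    assume "lin_indpt_family n f I"
    then have inj: "inj_on f I" and li: "V.lin_indpt (f ` I)" by (auto simp: lin_indpt_family_def)
    show ?R
    proof (intro allI impI ballI)
      fix c i assume c: "\<forall>j<n. (\<Sum>i\<in>I. c i * f i $ j) = 0" and i: "i \<in> I"
      define a where "a = c \<circ> the_inv_into I f"
      have af: "a (f i) = c i" if "i \<in> I" for i
        using the_inv_into_f_f[OF inj that] by (simp add: a_def)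
      have "V.lincomb a (f ` I) = 0\<^sub>v n"
      proof (rule eq_vecI)
        fix j assume "j < dim_vec (0\<^sub>v n :: 'a vec)"
        then have j: "j < n" by simp
        have "V.lincomb a (f ` I) $ j = (\<Sum>i\<in>I. a (f i) * f i $ j)"
          unfolding V.lincomb_index[OF j fI(1)] by (simp add: sum.reindex[OF inj])
        also have "\<dots> = (\<Sum>i\<in>I. c i * f i $ j)" by (intro sum.cong refl) (simp add: af)
        finally show "V.lincomb a (f ` I) $ j = 0\<^sub>v n $ j" using c j by simp
      qed (simp add: V.lincomb_dim[OF fI(2,1)])
      then have "a (f i) = 0" using V.lin_dep_crit[OF fI(2) order_refl, where a = a and v = "f i"] li i by auto
      then show "c i = 0" by (simp add: af[OF i])
    qed
  }
  {
    assume R: ?R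
    have "inj_on f I"
    proof (rule inj_onI, rule ccontr)
      fix i i' assume i: "i \<in> I" "i' \<in> I" "f i = f i'" "i \<noteq> i'"
      define c where "c l = (if l = i then 1 else 0) - (if l = i' then 1 else 0 :: 'a)" for l
      have "(\<Sum>l\<in>I. c l * f l $ j) = (\<Sum>l\<in>I. if l = i then f i $ j else 0) - (\<Sum>l\<in>I. if l = i' then f i' $ j else 0)" for j
        unfolding sum_subtractf[symmetric] by (intro sum.cong refl) (simp add: c_def)
      then have "(\<Sum>l\<in>I. c l * f l $ j) = 0" for j using i I by (simp add: sum.delta)
      then have "\<forall>i\<in>I. c i = 0" by (intro mp[OF spec[OF R]]) simp
      then have "c i = 0" using i(1) by (rule bspec)
      then show False using i(4) by (simp add: c_def)
    qed
    moreover have "V.lin_indpt (f ` I)"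
    proof (rule V.finite_lin_indpt2[OF fI(2)])
      fix a assume "V.lincomb a (f ` I) = 0\<^sub>v n"
      then have "(\<Sum>x\<in>f ` I. a x * x $ j) = 0" if "j < n" for j
        using V.lincomb_index[OF that fI(1), of a] that by simp
      then have "(\<Sum>i\<in>I. a (f i) * f i $ j) = 0" if "j < n" for j
        using that sum.reindex[OF \<open>inj_on f I\<close>, of "\<lambda>x. a x * x $ j"] by simp
      then have "\<forall>i\<in>I. a (f i) = 0" by (intro mp[OF spec[OF R]]) simp
      then show "\<forall>v\<in>f ` I. a v = 0" by simp
    qed (use fI in simp)
    ultimately show "lin_indpt_family n f I" by (simp add: lin_indpt_family_def)
  }
qed

lemma lin_indpt_familyD:
  fixes f :: "'i \<Rightarrow> 'a :: field vec"
  assumes "lin_indpt_family n f I" "finite I" "\<And>i. i \<in> I \<Longrightarrow> f i \<in> carrier_vec n"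
    "\<And>j. j < n \<Longrightarrow> (\<Sum>i\<in>I. c i * f i $ j) = 0" "i \<in> I"
  shows "c i = 0"
proof -
  have "\<forall>c. (\<forall>j<n. (\<Sum>i\<in>I. c i * f i $ j) = 0) \<longrightarrow> (\<forall>i\<in>I. c i = 0)"
    using assms(1) by (simp only: lin_indpt_family_iff[OF assms(2,3)])
  from mp[OF spec[OF this, of c]] show ?thesis using assms(4,5) by simp
qed

lemma lin_indpt_familyI:
  fixes f :: "'i \<Rightarrow> 'a :: field vec"
  assumes "finite I" "\<And>i. i \<in> I \<Longrightarrow> f i \<in> carrier_vec n"
    "\<And>c i. (\<And>j. j < n \<Longrightarrow> (\<Sum>i\<in>I. c i * f i $ j) = 0) \<Longrightarrow> i \<in> I \<Longrightarrow> c i = 0"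
  shows "lin_indpt_family n f I"
proof (rule iffD2[OF lin_indpt_family_iff[OF assms(1)]])
  show "f i \<in> carrier_vec n" if "i \<in> I" for i by (rule assms(2)[OF that])
  show "\<forall>c. (\<forall>j<n. (\<Sum>i\<in>I. c i * f i $ j) = 0) \<longrightarrow> (\<forall>i\<in>I. c i = 0)"
  proof (intro allI impI ballI)
    fix c i assume c: "\<forall>j<n. (\<Sum>i\<in>I. c i * f i $ j) = 0" and i: "i \<in> I"
    show "c i = 0" by (rule assms(3)[OF _ i]) (use c in simp)
  qed
qed

lemma lin_indpt_family_subset:
  fixes f :: "'i \<Rightarrow> 'a :: field vec"
  assumes "lin_indpt_family n f I" "J \<subseteq> I"
  shows "lin_indpt_family n f J"
proof -
  interpret V: vec_space "TYPE('a)" n .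
  have li: "V.lin_indpt (f ` I)" and inj: "inj_on f I" using assms(1) by (auto simp: lin_indpt_family_def)
  show ?thesis
    using V.subset_li_is_li[OF li image_mono[OF assms(2)]] inj_on_subset[OF inj assms(2)]
    by (simp add: lin_indpt_family_def)
qed

section \<open>Eigenvectors relative to a triangular basis\<close>

lemma eigenvectorD:
  assumes "A \<in> carrier_mat n n" "eigenvector A v \<mu>"
  shows "v \<in> carrier_vec n" "v \<noteq> 0\<^sub>v n" "\<And>j. j < n \<Longrightarrow> (\<Sum>l<n. A $$ (j, l) * v $ l) = \<mu> * v $ j"
proof -
  show v: "v \<in> carrier_vec n" "v \<noteq> 0\<^sub>v n" using assms by (auto simp: eigenvector_def)
  show "(\<Sum>l<n. A $$ (j, l) * v $ l) = \<mu> * v $ j" if j: "j < n" for j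
  proof -
    have "(\<Sum>l<n. A $$ (j, l) * v $ l) = (A *\<^sub>v v) $ j"
      using assms(1) v j by (auto simp: scalar_prod_def lessThan_atLeast0 intro!: sum.cong)
    also have "\<dots> = \<mu> * v $ j" using assms(2) v j by (simp add: eigenvector_def)
    finally show ?thesis .
  qed
qed

text \<open>
  Applying powers of \<open>A\<close> to a relation multiplies its coefficients by polynomials in the eigenvalues,
  which isolates a single eigenspace.
\<close>

lemma eigenvectors_independent:
  fixes A :: "complex mat"
  assumes A: "A \<in> carrier_mat n n" and I: "finite I"
    and ev: "\<And>i. i \<in> I \<Longrightarrow> eigenvector A (v i) (lam i)"
    and ind: "indep_in_eigenspaces n lam v I"
  shows "lin_indpt_family n v I"
proof (rule lin_indpt_familyI[OF I])
  show "v i \<in> carrier_vec n" if "i \<in> I" for i by (rule eigenvectorD(1)[OF A ev[OF that]])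
  fix c i0 assume c: "\<And>j. j < n \<Longrightarrow> (\<Sum>i\<in>I. c i * v i $ j) = 0" and i0: "i0 \<in> I"
  have power: "(\<Sum>i\<in>I. c i * lam i ^ m * v i $ j) = 0" if "j < n" for m j
    using that
  proof (induction m arbitrary: j)
    case 0
    then show ?case using c by simp
  next
    case (Suc m)
    have "(\<Sum>i\<in>I. c i * lam i ^ Suc m * v i $ j) = (\<Sum>i\<in>I. c i * lam i ^ m * (\<Sum>l<n. A $$ (j, l) * v i $ l))"
      using eigenvectorD(3)[OF A ev Suc.prems] by (intro sum.cong refl) simp
    also have "\<dots> = (\<Sum>l<n. A $$ (j, l) * (\<Sum>i\<in>I. c i * lam i ^ m * v i $ l))"
      unfolding sum_distrib_left by (subst sum.swap) (simp add: mult_ac)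
    also have "\<dots> = 0" using Suc.IH by simp
    finally show ?case .
  qed
  have poly: "(\<Sum>i\<in>I. c i * poly q (lam i) * v i $ j) = 0" if "j < n" for q j
  proof -
    have "(\<Sum>i\<in>I. c i * poly q (lam i) * v i $ j) =
        (\<Sum>m\<le>degree q. coeff q m * (\<Sum>i\<in>I. c i * lam i ^ m * v i $ j))"
      unfolding poly_altdef sum_distrib_left sum_distrib_right by (subst sum.swap) (simp add: mult_ac)
    then show ?thesis using power[OF that] by simp
  qed
  let ?\<mu> = "lam i0"
  let ?E = "{i \<in> I. lam i = ?\<mu>}"
  \<comment> \<open>The factors run over the other eigenvalues in the family, so \<open>q\<close>
    kills precisely the terms outside the eigenspace of \<open>?\<mu>\<close>.\<close>
  define q where "q = (\<Prod>\<nu>\<in>lam ` I - {?\<mu>}. [:- \<nu>, 1:])"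
  have q0: "poly q (lam i) = 0" if "i \<in> I" "lam i \<noteq> ?\<mu>" for i
    unfolding q_def poly_prod using that I by (intro prod_zero) auto
  have q\<mu>: "poly q ?\<mu> \<noteq> 0" unfolding q_def poly_prod using I by (simp add: prod_zero_iff)
  have E: "(\<Sum>i\<in>?E. c i * v i $ j) = 0" if j: "j < n" for j
  proof -
    have "poly q ?\<mu> * (\<Sum>i\<in>?E. c i * v i $ j) = (\<Sum>i\<in>?E. c i * poly q (lam i) * v i $ j)"
      unfolding sum_distrib_left by (intro sum.cong refl) (simp add: mult_ac)
    also have "\<dots> = (\<Sum>i\<in>I. c i * poly q (lam i) * v i $ j)"
      using I q0 by (intro sum.mono_neutral_left) auto
    finally show ?thesis using poly[OF j] q\<mu> by simp
  qed
  have li: "lin_indpt_family n v ?E" using ind by (simp add: indep_in_eigenspaces_def)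
  have i0E: "i0 \<in> ?E" "finite ?E" using i0 I by auto
  have "v i \<in> carrier_vec n" if "i \<in> ?E" for i using that by (intro eigenvectorD(1)[OF A ev]) auto
  from lin_indpt_familyD[of n v ?E c, OF li i0E(2) this E i0E(1)] show "c i0 = 0" .
qed

text \<open>In the basis \<open>P\<close> the eigenvector becomes an eigenvector of
  \<open>T\<close>. Back substitution from the last row upwards makes each coordinate vanish as long
  as the diagonal entry differs from \<mu>.\<close>

lemma eigenvector_in_leading_span:
  fixes B P Q T :: "complex mat"
  assumes B: "B \<in> carrier_mat n n" and P: "P \<in> carrier_mat n n" and Q: "Q \<in> carrier_mat n n"
    and T: "T \<in> carrier_mat n n" and PQ: "P * Q = 1\<^sub>m n" and QP: "Q * P = 1\<^sub>m n"
    and ut: "upper_triangular T" and BP: "B * P = P * T" and ev: "eigenvector B v \<mu>" and k: "k \<le> n"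
    and ne: "\<And>l. k \<le> l \<Longrightarrow> l < n \<Longrightarrow> T $$ (l, l) \<noteq> \<mu>"
  obtains e where "\<And>j. j < n \<Longrightarrow> v $ j = (\<Sum>l = 0..<k. P $$ (j, l) * e l)"
proof -
  have v: "v \<in> carrier_vec n" by (rule eigenvectorD(1)[OF B ev])
  define e where "e = Q *\<^sub>v v"
  have e: "e \<in> carrier_vec n" using Q v by (simp add: e_def)
  have "Q * B = (Q * B) * (P * Q)" using B Q by (simp add: PQ)
  also have "\<dots> = Q * (B * P) * Q"
    using B P Q by (simp add: assoc_mult_mat[of _ n n _ n _ n])
  also have "\<dots> = (Q * P) * T * Q" unfolding BP using P Q T by (simp add: assoc_mult_mat[of _ n n _ n _ n])
  also have "\<dots> = T * Q" using T by (simp add: QP)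
  finally have QB: "Q * B = T * Q" .
  have "T *\<^sub>v e = (T * Q) *\<^sub>v v" by (simp only: e_def assoc_mult_mat_vec[OF T Q v])
  also have "\<dots> = Q *\<^sub>v (B *\<^sub>v v)" by (simp only: QB[symmetric] assoc_mult_mat_vec[OF Q B v])
  also have "\<dots> = \<mu> \<cdot>\<^sub>v e" using ev Q v B by (simp add: eigenvector_def e_def mult_mat_vec)
  finally have Te: "T *\<^sub>v e = \<mu> \<cdot>\<^sub>v e" .
  have e0: "e $ l = 0" if "k \<le> l" "l < n" for l
    using that
  proof (induction "n - l" arbitrary: l rule: less_induct)
    case less
    have "(\<Sum>m = 0..<n. T $$ (l, m) * e $ m) = (T *\<^sub>v e) $ l"
      using T e less.prems by (auto simp: scalar_prod_def intro!: sum.cong)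
    also have "\<dots> = \<mu> * e $ l" unfolding Te using e less.prems by simp
    finally have "\<mu> * e $ l = (\<Sum>m = 0..<n. T $$ (l, m) * e $ m)" ..
    also have "\<dots> = (\<Sum>m = 0..<n. if m = l then T $$ (l, l) * e $ l else 0)"
    proof (intro sum.cong refl)
      fix m assume m: "m \<in> {0..<n}"
      show "T $$ (l, m) * e $ m = (if m = l then T $$ (l, l) * e $ l else 0)"
      proof (cases m l rule: linorder_cases)
        case less
        then show ?thesis using upper_triangularD[OF ut, of m l] T less.prems by simp
      next
        case greater
        then show ?thesis using less.hyps[of m] less.prems m by simp
      qed simp
    qed
    also have "\<dots> = T $$ (l, l) * e $ l" using less.prems by (simp add: sum.delta)
    finally show ?case using ne[OF less.prems] by simp
  qed
  have "v = (P * Q) *\<^sub>v v" using v by (simp add: PQ)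
  also have "\<dots> = P *\<^sub>v e" by (simp only: e_def assoc_mult_mat_vec[OF P Q v])
  finally have "v = P *\<^sub>v e" .
  then have "v $ j = (\<Sum>l = 0..<k. P $$ (j, l) * e $ l)" if j: "j < n" for j
  proof -
    have "v $ j = (P *\<^sub>v e) $ j" using \<open>v = P *\<^sub>v e\<close> by (rule arg_cong)
    also have "\<dots> = (\<Sum>l = 0..<n. P $$ (j, l) * e $ l)"
      using P e j by (auto simp: scalar_prod_def intro!: sum.cong)
    also have "\<dots> = (\<Sum>l = 0..<k. P $$ (j, l) * e $ l)"
      using k e0 by (intro sum.mono_neutral_right) auto
    finally show ?thesis .
  qed
  then show ?thesis using that by blast
qed

text \<open>Moving \<open>B\<close> across the pairing of \<open>v\<close> with column l expresses
  \<mu> times this pairing through those with columns up to l. By induction only the diagonal term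
  survives, and it is not \<mu> times the pairing unless that is 0. The pairing is bilinear, without
  conjugation.\<close>

lemma eigenvector_orthogonal_to_left_span:
  fixes B Q T :: "complex mat"
  assumes B: "B \<in> carrier_mat n n" and Q: "Q \<in> carrier_mat n n" and T: "T \<in> carrier_mat n n"
    and ut: "upper_triangular T" and BQ: "transpose_mat B * Q = Q * T" and ev: "eigenvector B v \<mu>"
    and k: "k \<le> n" and ne: "\<And>l. l < k \<Longrightarrow> T $$ (l, l) \<noteq> \<mu>" and l: "l < k"
  shows "(\<Sum>j<n. v $ j * Q $$ (j, l)) = 0"
  using l
proof (induction l rule: less_induct)
  case (less l)
  let ?s = "\<lambda>l. \<Sum>j<n. v $ j * Q $$ (j, l)"
  have l: "l < n" using less.prems k by simp
  have "\<mu> * ?s l = (\<Sum>m<n. (\<Sum>j<n. B $$ (m, j) * v $ j) * Q $$ (m, l))"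
    unfolding sum_distrib_left by (intro sum.cong refl) (simp add: eigenvectorD(3)[OF B ev])
  also have "\<dots> = (\<Sum>j<n. v $ j * (\<Sum>m<n. B $$ (m, j) * Q $$ (m, l)))"
    unfolding sum_distrib_left sum_distrib_right by (subst sum.swap) (simp add: mult_ac)
  also have "\<dots> = (\<Sum>j<n. v $ j * (transpose_mat B * Q) $$ (j, l))"
    using B Q l by (intro sum.cong refl) (auto simp: scalar_prod_def lessThan_atLeast0 intro!: sum.cong)
  also have "\<dots> = (\<Sum>j<n. v $ j * (\<Sum>m<n. Q $$ (j, m) * T $$ (m, l)))"
    unfolding BQ using Q T l by (intro sum.cong refl) (auto simp: scalar_prod_def lessThan_atLeast0 intro!: sum.cong)
  also have "\<dots> = (\<Sum>m<n. T $$ (m, l) * ?s m)"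
    unfolding sum_distrib_left by (subst sum.swap) (simp add: mult_ac)
  also have "\<dots> = (\<Sum>m<n. if m = l then T $$ (l, l) * ?s l else 0)"
  proof (intro sum.cong refl)
    fix m assume m: "m \<in> {..<n}"
    show "T $$ (m, l) * ?s m = (if m = l then T $$ (l, l) * ?s l else 0)"
    proof (cases m l rule: linorder_cases)
      case less': less
      then have "?s m = 0" using less.IH[of m] less.prems by simp
      then show ?thesis using less' by simp
    next
      case greater
      then show ?thesis using upper_triangularD[OF ut, of l m] T m by simp
    qed simp
  qed
  also have "\<dots> = T $$ (l, l) * ?s l" using l by (simp add: sum.delta)
  finally show ?case using ne[OF less.prems] by simp
qed

text \<open>The Schur decomposition places the eigenvalues on the diagonal in the order of the list
  that it receives. Hence leading columns of \<open>P\<close> belong to leading eigenvalues; the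
  shift by one reconciles matrix indices with the numbering of \<open>lam\<close>.\<close>

lemma complex_schur_frame:
  fixes B :: "complex mat"
  assumes B: "B \<in> carrier_mat n n" and cp: "char_poly B = (\<Prod>i = 1..n. [:- lam i, 1:])"
  obtains P Q T where "P \<in> carrier_mat n n" "Q \<in> carrier_mat n n" "T \<in> carrier_mat n n"
    "P * Q = 1\<^sub>m n" "Q * P = 1\<^sub>m n" "upper_triangular T" "B * P = P * T"
    "\<And>i. i < n \<Longrightarrow> T $$ (i, i) = lam (Suc i)"
proof -
  let ?es = "map lam [1..<Suc n]"
  have "(\<Prod>e\<leftarrow>?es. [:- e, 1:]) = (\<Prod>i = 1..n. [:- lam i, 1:])"
    by (simp add: prod.distinct_set_conv_list[symmetric] comp_def atLeastLessThanSuc_atLeastAtMost del: upt_Suc)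
  then have c: "char_poly B = (\<Prod>e\<leftarrow>?es. [:- e, 1:])" using cp by simp
  obtain T P Q where "schur_decomposition B ?es = (T, P, Q)" by (cases "schur_decomposition B ?es") auto
  from schur_decomposition[OF B c this]
  have sim: "similar_mat_wit B T P Q" and ut: "upper_triangular T" and d: "diag_mat T = ?es" by auto
  note w = similar_mat_witD2[OF B sim]
  have "B * P = P * T * (Q * P)"
    unfolding w(3) using w(5-7) by (simp add: assoc_mult_mat[of _ n n _ n _ n])
  then have "B * P = P * T" using w by simp
  moreover have "T $$ (i, i) = lam (Suc i)" if "i < n" for i
  proof -
    have "T $$ (i, i) = diag_mat T ! i" using w(5) that by (simp add: diag_mat_def)
    then show ?thesis unfolding d using that by (simp del: upt_Suc)
  qed
  ultimately show ?thesis using that w ut by blast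
qed

section \<open>Passage between complex eigenvectors and real vectors\<close>

text \<open>A real relation between real and imaginary parts is rewritten as a complex relation
  between the conjugate vectors. This requires both members of each pair to be in the list, hence
  the condition at its end.\<close>

lemma real_family_independent:
  assumes v: "\<And>i. i \<in> {1..k} \<Longrightarrow> v i \<in> carrier_vec n"
    and paired: "\<And>i. i \<in> {1..k} \<Longrightarrow> pair_start v i \<Longrightarrow> v (Suc i) = conjugate (v i)"
    and k: "\<not> pair_start v k" and ind: "lin_indpt_family n v {1..k}"
  shows "lin_indpt_family n (real_family v) {1..k}"
proof -
  have u: "real_family v i \<in> carrier_vec n" if "i \<in> {1..k}" for i
  proof (cases "pair_start v (i - 1)")
    case True
    then have "i - 1 \<in> {1..k}" using that by (cases "i - 1") auto
    then show ?thesis using v True by (auto simp: real_family_def)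
  next
    case False
    then show ?thesis using v[OF that] by (auto simp: real_family_def)
  qed
  have van: "a i0 = 0" if a: "\<And>j. j < n \<Longrightarrow> (\<Sum>i = 1..k. a i * real_family v i $ j) = 0" and i0: "i0 \<in> {1..k}" for a i0
  proof -
    \<comment> \<open>For real a and b, a Re z + b Im z equals (a - i b)/2 times z plus (a + i b)/2
      times the conjugate of z. If these coefficients vanish, so do a and b.\<close>
    define d where "d i = (if pair_start v i then (complex_of_real (a i) - \<i> * complex_of_real (a (Suc i))) / 2
      else if pair_start v (i - 1) then (complex_of_real (a (i - 1)) + \<i> * complex_of_real (a i)) / 2
      else complex_of_real (a i))" for i
    have sum: "(\<Sum>i = 1..r. d i * v i $ j) = complex_of_real (\<Sum>i = 1..r. a i * real_family v i $ j)"
      if "r \<le> k" "\<not> pair_start v r" "j < n" for r j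
      using that
    proof (induction r rule: less_induct)
      case (less r)
      show ?case
      proof (cases r)
        case 0
        then show ?thesis by simp
      next
        case (Suc s)
        have vr: "dim_vec (v r) = n" using v[of r] less.prems Suc by auto
        show ?thesis
        proof (cases "pair_start v s")
          case False
          then have "conjugate (v r) = v r" using less.prems(2) Suc by simp
          then have "cnj (v r $ j) = v r $ j"
            using vr less.prems(3) vec_index_conjugate[of j "v r"] by simp
          then have "v r $ j = complex_of_real (Re (v r $ j))" by (metis Reals_cnj_iff of_real_Re)
          moreover have "d r = complex_of_real (a r)" using less.prems(2) False Suc by (simp add: d_def)
          moreover have "real_family v r $ j = Re (v r $ j)"
            using False Suc vr less.prems by (simp add: real_family_def)
          ultimately have "d r * v r $ j = complex_of_real (a r * real_family v r $ j)"
            by (metis of_real_mult)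
          then show ?thesis using less.IH[of s] less.prems False Suc by simp
        next
          case True
          then obtain t where s: "s = Suc t" by (cases s) auto
          have t: "\<not> pair_start v t" using True s by simp
          have vs: "dim_vec (v s) = n" using v[of s] less.prems Suc s by auto
          have "v r = conjugate (v s)" using paired[OF _ True] less.prems Suc s by simp
          then have vr: "v r $ j = cnj (v s $ j)" using vs less.prems(3) by simp
          have ds: "d s = (complex_of_real (a s) - \<i> * complex_of_real (a r)) / 2"
            "d r = (complex_of_real (a s) + \<i> * complex_of_real (a r)) / 2"
            using True less.prems(2) Suc by (auto simp: d_def)
          have us: "real_family v s $ j = Re (v s $ j)" "real_family v r $ j = Im (v s $ j)"
            using True t s Suc vs less.prems(3) by (simp_all add: real_family_def)
          have "d s * v s $ j + d r * v r $ j =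
              complex_of_real (a s * real_family v s $ j + a r * real_family v r $ j)"
            unfolding ds us vr by (simp add: complex_eq_iff field_simps)
          then show ?thesis using less.IH[of t] less.prems t s Suc by (simp add: add.assoc)
        qed
      qed
    qed
    have d: "(\<Sum>i = 1..k. d i * v i $ j) = 0" if "j < n" for j
      unfolding sum[OF order_refl k that] a[OF that] by simp
    have d0: "d i = 0" if "i \<in> {1..k}" for i
      by (rule lin_indpt_familyD[where c = d, OF ind finite_atLeastAtMost v d that])
    show ?thesis
    proof (cases "pair_start v i0")
      case True
      then show ?thesis using d0[OF i0] by (simp add: d_def complex_eq_iff)
    next
      case False
      show ?thesis
      proof (cases "pair_start v (i0 - 1)")
        case True
        then have "i0 - 1 \<in> {1..k}" "Suc (i0 - 1) = i0" using i0 by (cases "i0 - 1", auto)+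
        then show ?thesis using d0[of "i0 - 1"] True by (simp add: d_def complex_eq_iff)
      next
        case F: False
        then show ?thesis using d0[OF i0] False by (simp add: d_def)
      qed
    qed
  qed
  show ?thesis by (rule lin_indpt_familyI) (simp, fact u, fact van)
qed

text \<open>Independence is what keeps the combination nonzero, as it must be: the zero vector has
  the largest possible \<open>s_plus\<close> and no sign variation in the sense of
  \<open>s_minus\<close>.\<close>

lemma matching_combination:
  assumes v: "\<And>i. i \<in> {1..n} \<Longrightarrow> v i \<in> carrier_vec n" and cp: "conj_paired n v"
    and mt: "matches v p q c" and pq: "1 \<le> p" "q \<le> n"
    and ind: "lin_indpt_family n v {p..q}"
  shows "Re_vec (eig_comb n c v p q) \<in> carrier_vec n" "Re_vec (eig_comb n c v p q) \<noteq> 0\<^sub>v n"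
    "\<And>j. j < n \<Longrightarrow> complex_of_real (Re_vec (eig_comb n c v p q) $ j) = (\<Sum>i = p..q. c i * v i $ j)"
proof -
  let ?y = "Re_vec (eig_comb n c v p q)"
  have vc: "v i \<in> carrier_vec n" if "i \<in> {p..q}" for i using v[of i] that pq by auto
  have dim: "eig_comb n c v p q \<in> carrier_vec n"
    unfolding eig_comb_def using vc by (intro finsum_vec_closed) auto
  then show y: "?y \<in> carrier_vec n" by simp
  show entry: "complex_of_real (?y $ j) = (\<Sum>i = p..q. c i * v i $ j)" if j: "j < n" for j
  proof -
    have "complex_of_real (?y $ j) = map_vec complex_of_real ?y $ j" using dim j by simp
    also have "\<dots> = eig_comb n c v p q $ j"
      by (rule arg_cong[OF matches_imp_real[OF v cp mt pq], of "\<lambda>u. u $ j"])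
    finally show ?thesis using eig_comb_index[OF vc j] by simp
  qed
  show "?y \<noteq> 0\<^sub>v n"
  proof
    assume "?y = 0\<^sub>v n"
    then have s0: "(\<Sum>i = p..q. c i * v i $ j) = 0" if "j < n" for j using entry[OF that] that by simp
    have "c i = 0" if "i \<in> {p..q}" for i by (rule lin_indpt_familyD[where c = c, OF ind finite_atLeastAtMost vc s0 that])
    then show False using mt by (auto simp: matches_def)
  qed
qed

section \<open>The two Schur frames and the eigenvalue gap combined\<close>

theorem theorem2:
  fixes A :: "real mat" and n k :: nat and \<epsilon> :: real
    and lam :: "nat \<Rightarrow> complex" and v :: "nat \<Rightarrow> complex vec"
  assumes "A \<in> carrier_mat n n" and "invertible_mat A"
    and "1 \<le> k" and "k \<le> n - 1" and "SSR k A"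
    and "\<epsilon> \<in> {-1, 1}" and "\<forall>x \<in> minors k A. sgn x = \<epsilon>"
    and "ordered_eigenvalues n A lam"
    and "corresponding_eigenvectors n A lam v"
  shows "((\<Prod>i = 1..k. lam i) \<in> \<real> \<and> \<epsilon> * Re (\<Prod>i = 1..k. lam i) > 0) \<and>
    cmod (lam k) > cmod (lam (k + 1)) \<and>
    (\<forall>p q c. 1 \<le> p \<and> p \<le> k \<and> k + 1 \<le> q \<and> q \<le> n \<and>
       indep_in_eigenspaces n lam v {p..q} \<and>
       matches v p k c \<and> matches v (k + 1) q c \<longrightarrow>
       s_plus (Re_vec (eig_comb n c v p k)) \<le> k - 1 \<and>
       s_minus (Re_vec (eig_comb n c v (k + 1) q)) \<ge> k) \<and>
    (indep_in_eigenspaces n lam v {1..k} \<longrightarrow>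
       lin_indpt_family n (real_family v) {1..k} \<and>
       ((\<forall>i \<in> {1..k}. conjugate (v i) = v i) \<longrightarrow> lin_indpt_family n v {1..k}))"
proof -
  note A = assms(1) and \<epsilon> = assms(6)
  have k: "0 < k" "k < n" "k \<le> n" using assms(3,4) by auto
  define B where "B = map_mat complex_of_real A"
  have B: "B \<in> carrier_mat n n" and AT: "transpose_mat A \<in> carrier_mat n n" using A by (auto simp: B_def)
  have BT: "map_mat complex_of_real (transpose_mat A) = transpose_mat B" by (simp add: B_def map_mat_transpose)
  have cp: "char_poly B = (\<Prod>i = 1..n. [:- lam i, 1:])"
    and mono: "\<And>i j. 1 \<le> i \<Longrightarrow> i \<le> j \<Longrightarrow> j \<le> n \<Longrightarrow> cmod (lam j) \<le> cmod (lam i)"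
    using assms(8) by (auto simp: ordered_eigenvalues_def B_def)
  have ev: "\<And>i. i \<in> {1..n} \<Longrightarrow> eigenvector B (v i) (lam i)" and vp: "conj_paired n v"
    using assms(9) by (auto simp: corresponding_eigenvectors_def B_def)
  have v: "v i \<in> carrier_vec n" if "i \<in> {1..n}" for i by (rule eigenvectorD(1)[OF B ev[OF that]])
  have pos: "0 < \<epsilon> * det (submatrix A I J)" if I: "I \<in> index_sets n k" and J: "J \<in> index_sets n k" for I J
  proof -
    have "det (submatrix A I J) \<in> minors k A"
      using index_setsD(1,2)[OF I] index_setsD(1,2)[OF J] A unfolding minors_def by blast
    then have "sgn (det (submatrix A I J)) = \<epsilon>" using assms(7) by blast
    then show ?thesis using \<epsilon> by (auto simp: sgn_if split: if_splits)
  qed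
  have posT: "0 < \<epsilon> * det (submatrix (transpose_mat A) I J)"
    if I: "I \<in> index_sets n k" and J: "J \<in> index_sets n k" for I J
  proof -
    have "submatrix (transpose_mat A) I J = transpose_mat (submatrix A J I)"
      unfolding submatrix_eq[OF AT I J] submatrix_eq[OF A J I]
      using pick_index_sets[OF I] pick_index_sets[OF J] A by (intro eq_matI) auto
    then show ?thesis using pos[OF J I] by (simp add: det_transpose[OF submatrix_carrier[OF A J I]])
  qed
  obtain P Q T where P: "P \<in> carrier_mat n n" and Q: "Q \<in> carrier_mat n n" and T: "T \<in> carrier_mat n n"
    and PQ: "P * Q = 1\<^sub>m n" and QP: "Q * P = 1\<^sub>m n" and ut: "upper_triangular T" and BP: "B * P = P * T"
    and Td: "\<And>i. i < n \<Longrightarrow> T $$ (i, i) = lam (Suc i)"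
    using complex_schur_frame[OF B cp] by blast
  \<comment> \<open>The transpose has the same characteristic polynomial and, with the index sets
    exchanged, the same minors. Its frame therefore also has one-signed leading minors; it supplies
    the equations for the second group of eigenvectors.\<close>
  obtain P' Q' T' where P': "P' \<in> carrier_mat n n" and Q': "Q' \<in> carrier_mat n n" and T': "T' \<in> carrier_mat n n"
    and PQ': "P' * Q' = 1\<^sub>m n" and QP': "Q' * P' = 1\<^sub>m n" and ut': "upper_triangular T'"
    and BP': "transpose_mat B * P' = P' * T'" and Td': "\<And>i. i < n \<Longrightarrow> T' $$ (i, i) = lam (Suc i)"
    using complex_schur_frame[of "transpose_mat B" n lam] B cp by (metis char_poly_transpose_mat transpose_carrier_mat)
  have dec: "cmod (T $$ (j, j)) \<le> cmod (T $$ (i, i))" if "i \<le> j" "j < n" for i j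
    using mono[of "Suc i" "Suc j"] that by (simp add: Td)
  have dec': "cmod (T' $$ (j, j)) \<le> cmod (T' $$ (i, i))" if "i \<le> j" "j < n" for i j
    using mono[of "Suc i" "Suc j"] that by (simp add: Td')
  have "\<exists>r \<theta> x. 0 < r \<and> complex_of_real \<epsilon> * (\<Prod>i = 0..<k. T $$ (i, i)) = complex_of_real r \<and>
      cmod (T $$ (k, k)) < cmod (T $$ (k - 1, k - 1)) \<and> cmod \<theta> = 1 \<and>
      (\<forall>I\<in>index_sets n k. det (submatrix P I {0..<k}) = \<theta> * complex_of_real (x I) \<and> 0 < x I)"
    by (rule compound_perron[OF A k(1,2) \<epsilon> pos P Q T PQ QP ut BP[unfolded B_def] dec]) blast+
  then obtain r \<theta> x where r: "0 < r" "complex_of_real \<epsilon> * (\<Prod>i = 0..<k. T $$ (i, i)) = complex_of_real r"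
    and gapT: "cmod (T $$ (k, k)) < cmod (T $$ (k - 1, k - 1))" and \<theta>: "cmod \<theta> = 1"
    and x: "\<And>I. I \<in> index_sets n k \<Longrightarrow> det (submatrix P I {0..<k}) = \<theta> * complex_of_real (x I)"
      "\<And>I. I \<in> index_sets n k \<Longrightarrow> 0 < x I"
    by blast
  have "\<exists>\<theta> x. cmod \<theta> = 1 \<and>
      (\<forall>I\<in>index_sets n k. det (submatrix P' I {0..<k}) = \<theta> * complex_of_real (x I) \<and> 0 < x I)"
    by (rule compound_perron[OF AT k(1,2) \<epsilon> posT P' Q' T' PQ' QP' ut' BP'[folded BT] dec']) blast+
  then obtain \<theta>' x' where \<theta>': "cmod \<theta>' = 1"
    and x': "\<And>I. I \<in> index_sets n k \<Longrightarrow> det (submatrix P' I {0..<k}) = \<theta>' * complex_of_real (x' I)"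
      "\<And>I. I \<in> index_sets n k \<Longrightarrow> 0 < x' I"
    by blast
  have nz: "\<theta> \<noteq> 0" "\<theta>' \<noteq> 0" using \<theta> \<theta>' by auto
  have gap: "cmod (lam (k + 1)) < cmod (lam k)" using gapT k by (simp add: Td)
  have prod: "(\<Prod>i = 1..k. lam i) = complex_of_real (\<epsilon> * r)"
  proof -
    have "(\<Prod>i = 1..k. lam i) = (\<Prod>i = 0..<k. T $$ (i, i))"
      using k by (auto simp: prod.atLeast1_atMost_eq lessThan_atLeast0 Td intro!: prod.cong)
    also have "\<dots> = complex_of_real \<epsilon> * (complex_of_real \<epsilon> * (\<Prod>i = 0..<k. T $$ (i, i)))" using \<epsilon> by auto
    finally show ?thesis by (simp only: r(2) of_real_mult)
  qed
  have ind: "lin_indpt_family n v I" if "indep_in_eigenspaces n lam v I" "I \<subseteq> {1..n}" for I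
    by (rule eigenvectors_independent[OF B _ ev that(1)]) (use that(2) in \<open>auto intro: finite_subset\<close>)
  have "s_plus (Re_vec (eig_comb n c v p k)) \<le> k - 1 \<and> s_minus (Re_vec (eig_comb n c v (k + 1) q)) \<ge> k"
    if pq: "1 \<le> p" "p \<le> k" "k + 1 \<le> q" "q \<le> n" and ie: "indep_in_eigenspaces n lam v {p..q}"
      and m1: "matches v p k c" and m2: "matches v (k + 1) q c" for p q c
  proof
    have sub: "{p..q} \<subseteq> {1..n}" using pq by auto
    have ind_low: "lin_indpt_family n v {p..k}" and ind_high: "lin_indpt_family n v {k + 1..q}"
      by (rule lin_indpt_family_subset[OF ind[OF ie sub]]; use pq in auto)+
    let ?y = "Re_vec (eig_comb n c v p k)"
    have y: "?y \<in> carrier_vec n" "?y \<noteq> 0\<^sub>v n"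
      "\<And>j. j < n \<Longrightarrow> complex_of_real (?y $ j) = (\<Sum>i = p..k. c i * v i $ j)"
      using matching_combination[OF v vp m1 pq(1) k(3) ind_low] by simp_all
    have "\<exists>e. \<forall>j<n. v i $ j = (\<Sum>l = 0..<k. P $$ (j, l) * e l)" if i: "i \<in> {p..k}" for i
    proof -
      \<comment> \<open>The gap separates moduli: eigenvalues up to index k are strictly larger than
        all later ones, even if there are coincidences within each group.\<close>
      have ne: "T $$ (l, l) \<noteq> lam i" if l: "k \<le> l" "l < n" for l
      proof -
        have "cmod (lam (Suc l)) \<le> cmod (lam (k + 1))" "cmod (lam k) \<le> cmod (lam i)"
          using mono[of "k + 1" "Suc l"] mono[of i k] l i pq by auto
        then show ?thesis using gap Td[OF l(2)] by auto
      qed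
      have "i \<in> {1..n}" using i pq by auto
      from eigenvector_in_leading_span[OF B P Q T PQ QP ut BP ev[OF this] k(3) ne]
      show ?thesis by blast
    qed
    then obtain e where e: "\<And>i j. i \<in> {p..k} \<Longrightarrow> j < n \<Longrightarrow> v i $ j = (\<Sum>l = 0..<k. P $$ (j, l) * e i l)"
      by metis
    have "complex_of_real (?y $ j) = (\<Sum>l = 0..<k. P $$ (j, l) * (\<Sum>i = p..k. c i * e i l))" if j: "j < n" for j
    proof -
      have "complex_of_real (?y $ j) = (\<Sum>i = p..k. c i * (\<Sum>l = 0..<k. P $$ (j, l) * e i l))"
        unfolding y(3)[OF j] by (intro sum.cong refl) (simp add: e[OF _ j])
      then show ?thesis
        unfolding sum_distrib_left by (subst (asm) sum.swap) (simp add: mult_ac)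
    qed
    from s_plus_less_frame[OF P k(1,3) y(1,2) x nz(1) this]
    show "s_plus ?y \<le> k - 1" by simp
    let ?z = "Re_vec (eig_comb n c v (k + 1) q)"
    have z: "?z \<in> carrier_vec n" "?z \<noteq> 0\<^sub>v n"
      "\<And>j. j < n \<Longrightarrow> complex_of_real (?z $ j) = (\<Sum>i = k + 1..q. c i * v i $ j)"
      using matching_combination[OF v vp m2 _ pq(4) ind_high] by simp_all
    have "(\<Sum>j<n. complex_of_real (?z $ j) * P' $$ (j, l)) = 0" if l: "l < k" for l
    proof -
      have "(\<Sum>j<n. v i $ j * P' $$ (j, l)) = 0" if i: "i \<in> {k + 1..q}" for i
      proof (rule eigenvector_orthogonal_to_left_span[OF B P' T' ut' BP' ev k(3) _ l])
        show "i \<in> {1..n}" using i pq by auto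
        show "T' $$ (l, l) \<noteq> lam i" if l: "l < k" for l
        proof -
          have "cmod (lam k) \<le> cmod (lam (Suc l))" "cmod (lam i) \<le> cmod (lam (k + 1))"
            using mono[of "Suc l" k] mono[of "k + 1" i] l i pq k by auto
          then show ?thesis using gap Td'[of l] l k by auto
        qed
      qed
      moreover have "(\<Sum>j<n. complex_of_real (?z $ j) * P' $$ (j, l)) =
          (\<Sum>i = k + 1..q. c i * (\<Sum>j<n. v i $ j * P' $$ (j, l)))"
      proof -
        have "(\<Sum>j<n. complex_of_real (?z $ j) * P' $$ (j, l)) =
            (\<Sum>j<n. (\<Sum>i = k + 1..q. c i * v i $ j) * P' $$ (j, l))"
          by (intro sum.cong refl) (simp only: z(3) lessThan_iff)
        then show ?thesis
          unfolding sum_distrib_left sum_distrib_right by (subst (asm) sum.swap) (simp add: mult_ac)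
      qed
      ultimately show ?thesis by simp
    qed
    from le_s_minus_frame[OF P' k(1,3) z(1,2) x' nz(2) this]
    show "s_minus ?z \<ge> k" .
  qed
  moreover have "lin_indpt_family n (real_family v) {1..k} \<and> lin_indpt_family n v {1..k}"
    if ie: "indep_in_eigenspaces n lam v {1..k}"
  proof
    have vk: "v i \<in> carrier_vec n" if "i \<in> {1..k}" for i using v[of i] that k by simp
    show li: "lin_indpt_family n v {1..k}" by (rule ind[OF ie]) (use k in auto)
    \<comment> \<open>Since \<open>A\<close> is real, a conjugate pair of eigenvectors straddling k
      and k + 1 would belong to conjugate eigenvalues. These have equal modulus, against the gap.
      The pairing of the vectors alone does not say this about \<open>lam\<close>, so it is derived
      from the eigenvector equations.\<close>
    have "\<not> pair_start v k"
    proof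
      assume "pair_start v k"
      then have vs: "v (Suc k) = conjugate (v k)" using vp k by (auto simp: conj_paired_def)
      have vkc: "v k \<in> carrier_vec n" "v k \<noteq> 0\<^sub>v n"
        and e1: "\<And>j. j < n \<Longrightarrow> (\<Sum>l<n. B $$ (j, l) * v k $ l) = lam k * v k $ j"
        using eigenvectorD[OF B ev[of k]] k by auto
      have e2: "(\<Sum>l<n. B $$ (j, l) * v (Suc k) $ l) = lam (Suc k) * v (Suc k) $ j" if "j < n" for j
        using eigenvectorD(3)[OF B ev[of "Suc k"] that] k by auto
      obtain j where j: "j < n" "v k $ j \<noteq> 0" using vkc by (metis carrier_vecD eq_vecI index_zero_vec)
      have vc: "v (Suc k) $ l = cnj (v k $ l)" if "l < n" for l using vs vkc that by simp
      have "lam (Suc k) * cnj (v k $ j) = (\<Sum>l<n. B $$ (j, l) * cnj (v k $ l))"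
        unfolding e2[OF j(1), unfolded vc[OF j(1)], symmetric] by (intro sum.cong refl) (simp add: vc)
      also have "\<dots> = cnj (\<Sum>l<n. B $$ (j, l) * v k $ l)"
        using A j by (auto simp: B_def intro!: sum.cong)
      also have "\<dots> = cnj (lam k) * cnj (v k $ j)" by (simp add: e1[OF j(1)])
      finally have "lam (Suc k) = cnj (lam k)" using j(2) by simp
      then show False using gap by simp
    qed
    then show "lin_indpt_family n (real_family v) {1..k}"
      using vp k by (intro real_family_independent vk li) (auto simp: conj_paired_def)
  qed
  moreover have "0 < \<epsilon> * Re (\<Prod>i = 1..k. lam i)" using \<epsilon> r(1) unfolding prod by auto
  moreover have "(\<Prod>i = 1..k. lam i) \<in> \<real>" unfolding prod by simp
  ultimately show ?thesis using gap by blast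
qed

end
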